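(* Let $T>0$ and let $X=(X_t)_{t\in[0,T]}$ be a real-valued, pathwise continuous, centered Gaussian process with covariance function $C_X(s,t)=\mathbb{E}\,X_sX_t$, $s,t\in[0,T]$. Then $X$ satisfies a functional co-monotony principle on $\mathcal{C}([0,T],\mathbb{R})$ if and only if $C_X(s,t)\ge0$ for every $s,t\in[0,T]$.
   Context: $\mathcal{C}([0,T],\mathbb{R})$ is equipped with the sup-norm $\|\alpha\|_{\sup}=\sup_{t\in[0,T]}|\alpha(t)|$, its Borel $\sigma$-field, and the pointwise order: $\alpha\le\beta$ if $\alpha(t)\le\beta(t)$ for all $t\in[0,T]$. Two measurable functionals $F,G$ on this space are co-monotone if they are both non-decreasing or both non-increasing for this order. $F$ is $\mathbb{P}_X$-a.s. continuous if it is sup-norm continuous at every point of a set of probability $1$ under the distribution $\mathbb{P}_X$ of $X$. $X$ satisfies a functional co-monotony principle on $\mathcal{C}([0,T],\mathbb{R})$ if, for every pair of bounded, co-monotone, $\mathbb{P}_X$-a.s. continuous, measurable functionals $F,G:\mathcal{C}([0,T],\mathbb{R})\to\mathbb{R}$, $\mathbb{E}\,F(X)G(X)\ge\mathbb{E}\,F(X)\,\mathbb{E}\,G(X)$. *)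

theory Defs
  imports "HOL-Probability.Probability"
begin

(* The elements of cfunspace are extensional functions: a path on [0,T] is represented by a
   function real => real that is undefined outside {0..T}. *)
definition path_space :: "real \<Rightarrow> (real \<Rightarrow> real) metric" where
  "path_space T = cfunspace (top_of_set {0..T}) euclidean_metric"

lemma mspace_path_space:
  "mspace (path_space T) = {f \<in> extensional {0..T}. continuous_on {0..T} f}"
proof -
  have "Met_TC.mbounded (f ` {0..T})" if "continuous_on {0..T} f" for f :: "real \<Rightarrow> real"
    using compact_continuous_image[OF that] by (simp add: compact_imp_bounded)
  then show ?thesis
    by (auto simp: path_space_def Met_TC.fspace_def)
qed

lemma mdist_path_space:
  assumes "0 \<le> T" "f \<in> mspace (path_space T)" "g \<in> mspace (path_space T)"
  shows "mdist (path_space T) f g = (SUP t\<in>{0..T}. \<bar>f t - g t\<bar>)"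
  using assms
  by (auto simp: path_space_def mdist_cfunspace_eq_mdist_funspace Met_TC.fdist_def
      Met_TC.fspace_def dist_real_def)

definition path_borel :: "real \<Rightarrow> (real \<Rightarrow> real) measure" where
  "path_borel T = sigma (mspace (path_space T)) {U. openin (mtopology_of (path_space T)) U}"

definition path_le :: "real \<Rightarrow> (real \<Rightarrow> real) \<Rightarrow> (real \<Rightarrow> real) \<Rightarrow> bool" where
  "path_le T \<alpha> \<beta> \<longleftrightarrow> (\<forall>t\<in>{0..T}. \<alpha> t \<le> \<beta> t)"

definition comonotone :: "real \<Rightarrow> ((real \<Rightarrow> real) \<Rightarrow> real) \<Rightarrow> ((real \<Rightarrow> real) \<Rightarrow> real) \<Rightarrow> bool" where
  "comonotone T F G \<longleftrightarrow>
     monotone_on (mspace (path_space T)) (path_le T) (\<le>) F \<and>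
     monotone_on (mspace (path_space T)) (path_le T) (\<le>) G \<or>
     monotone_on (mspace (path_space T)) (path_le T) (\<ge>) F \<and>
     monotone_on (mspace (path_space T)) (path_le T) (\<ge>) G"

definition sample_path :: "real \<Rightarrow> (real \<Rightarrow> 'a \<Rightarrow> real) \<Rightarrow> 'a \<Rightarrow> (real \<Rightarrow> real)" where
  "sample_path T X \<omega> = restrict (\<lambda>t. X t \<omega>) {0..T}"

definition path_law :: "'a measure \<Rightarrow> real \<Rightarrow> (real \<Rightarrow> 'a \<Rightarrow> real) \<Rightarrow> (real \<Rightarrow> real) measure" where
  "path_law M T X = distr M (path_borel T) (sample_path T X)"

definition as_continuous ::
    "'a measure \<Rightarrow> real \<Rightarrow> (real \<Rightarrow> 'a \<Rightarrow> real) \<Rightarrow> ((real \<Rightarrow> real) \<Rightarrow> real) \<Rightarrow> bool" where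
  "as_continuous M T X F \<longleftrightarrow>
     (\<exists>A\<in>sets (path_borel T). measure (path_law M T X) A = 1 \<and>
        (\<forall>\<alpha>\<in>A. topcontinuous_at (mtopology_of (path_space T)) euclidean F \<alpha>))"

definition functional_comonotony :: "'a measure \<Rightarrow> real \<Rightarrow> (real \<Rightarrow> 'a \<Rightarrow> real) \<Rightarrow> bool" where
  "functional_comonotony M T X \<longleftrightarrow>
     (\<forall>F G. F \<in> borel_measurable (path_borel T) \<longrightarrow> G \<in> borel_measurable (path_borel T) \<longrightarrow>
        bounded (F ` mspace (path_space T)) \<longrightarrow> bounded (G ` mspace (path_space T)) \<longrightarrow>
        comonotone T F G \<longrightarrow> as_continuous M T X F \<longrightarrow> as_continuous M T X G \<longrightarrow>
        integral\<^sup>L M (\<lambda>\<omega>. F (sample_path T X \<omega>) * G (sample_path T X \<omega>))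
          \<ge> integral\<^sup>L M (\<lambda>\<omega>. F (sample_path T X \<omega>)) * integral\<^sup>L M (\<lambda>\<omega>. G (sample_path T X \<omega>)))"

(* Constants count as Gaussian (variance 0); they have no density, hence the separate case. *)
definition gaussian_rv :: "'a measure \<Rightarrow> ('a \<Rightarrow> real) \<Rightarrow> bool" where
  "gaussian_rv M Y \<longleftrightarrow> Y \<in> borel_measurable M \<and>
     ((\<exists>\<mu>. AE \<omega> in M. Y \<omega> = \<mu>) \<or>
      (\<exists>\<mu> \<sigma>. 0 < \<sigma> \<and> distributed M lborel Y (\<lambda>x. ennreal (normal_density \<mu> \<sigma> x))))"

definition gaussian_process :: "'a measure \<Rightarrow> real set \<Rightarrow> (real \<Rightarrow> 'a \<Rightarrow> real) \<Rightarrow> bool" where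
  "gaussian_process M I X \<longleftrightarrow>
     (\<forall>t\<in>I. X t \<in> borel_measurable M) \<and>
     (\<forall>J c. finite J \<longrightarrow> J \<subseteq> I \<longrightarrow> gaussian_rv M (\<lambda>\<omega>. \<Sum>t\<in>J. c t * X t \<omega>))"

(* For a centered process this is the covariance function. *)
definition cov_fun :: "'a measure \<Rightarrow> (real \<Rightarrow> 'a \<Rightarrow> real) \<Rightarrow> real \<Rightarrow> real \<Rightarrow> real" where
  "cov_fun M X s t = integral\<^sup>L M (\<lambda>\<omega>. X s \<omega> * X t \<omega>)"

end

(* Reduction to finite dimension: replacing F by its inf-convolution along constant shifts makes a
   bounded monotone functional Lipschitz, with convergence at the continuity points of F, and
   evaluating a Lipschitz functional at the Bernstein polynomials of the path leaves a monotone
   Lipschitz function of finitely many coordinates of X.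

   It remains to see that a Gaussian vector Y with nonnegative covariances is associated (Pitt).
   Put P_h f(x) = E f(x + sqrt h Y), a semigroup because Gaussian laws are stable. For increasing f, g
   with Lipschitz gradients, P_h(fg) - P_h f P_h g equals h times the covariance of <grad f, Y> and
   <grad g, Y>, which is nonnegative, up to an error O(h^(3/2)). The class of such f, g is invariant
   under P_h, so doubling the time m times, from 2^-m to 1, accumulates an error O(2^m 2^(-3m/2)),
   which vanishes in the limit; hence P_1(fg) >= P_1 f P_1 g. *)

theory Submission
  imports Defs
begin

section \<open>Laws of random sequences are determined by trigonometric waves\<close>

text \<open>The covariance may be degenerate: variances can vanish and grid times repeat. So no
  joint density and no Gaussian integration by parts is available. The semigroup law is read off
  from expectations of cos (\<theta> + l(Y)) with l a linear form, together with the fact that these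
  determine the law. Generators and differentiation under the integral are avoided as well: a
  gradient occurs only in a Taylor inequality with quadratic remainder, which survives averaging
  with the same constant. That uniformity lets the doubling close, since the constant of the
  short-time estimate must be the same at every level. The order h^(3/2) is a gradient term of size
  sqrt h times a Taylor remainder of size h. The linear terms have mean 0, so the product of the two
  mean increments is only of order h^2. Since 3/2 exceeds 1, 2^m such errors at h = 2^-m still
  vanish. Lipschitz gradients come from averaging a Lipschitz function over an interval of length
  \<epsilon> in each coordinate in turn. The converse tests the principle on evaluations at s and t,
  clipped to be bounded.\<close>

inductive trig_poly :: "('b \<Rightarrow> real) set \<Rightarrow> ('b \<Rightarrow> real) \<Rightarrow> bool" for L where
  wave: "l \<in> L \<Longrightarrow> trig_poly L (\<lambda>x. c * cos (\<theta> + l x))"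
| add: "trig_poly L f \<Longrightarrow> trig_poly L g \<Longrightarrow> trig_poly L (\<lambda>x. f x + g x)"

text \<open>The product-to-sum formula adds and subtracts frequencies, hence the two closure
  conditions on \<open>L\<close>. The free phase in \<open>wave\<close> provides sines, and
  constants at frequency 0, without complex exponentials.\<close>

lemma trig_poly_mult:
  assumes add_L: "\<And>l m. l \<in> L \<Longrightarrow> m \<in> L \<Longrightarrow> (\<lambda>x. l x + m x) \<in> L"
    and diff_L: "\<And>l m. l \<in> L \<Longrightarrow> m \<in> L \<Longrightarrow> (\<lambda>x. l x - m x) \<in> L"
    and "trig_poly L f" "trig_poly L g"
  shows "trig_poly L (\<lambda>x. f x * g x)"
  using assms(3)
proof induction
  case (wave l c \<theta>)
  note l = wave
  show ?case using assms(4)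
  proof induction
    case (wave m d \<eta>)
    have "(\<lambda>x. c * cos (\<theta> + l x) * (d * cos (\<eta> + m x))) =
        (\<lambda>x. c * d / 2 * cos ((\<theta> - \<eta>) + (l x - m x)) + c * d / 2 * cos ((\<theta> + \<eta>) + (l x + m x)))"
      (is "_ = ?r")
    proof
      fix x
      have "cos (\<theta> + l x) * cos (\<eta> + m x) =
          (cos ((\<theta> + l x) - (\<eta> + m x)) + cos ((\<theta> + l x) + (\<eta> + m x))) / 2"
        by (rule cos_times_cos)
      moreover have "(\<theta> + l x) - (\<eta> + m x) = (\<theta> - \<eta>) + (l x - m x)"
        "(\<theta> + l x) + (\<eta> + m x) = (\<theta> + \<eta>) + (l x + m x)" by simp_all
      ultimately have "cos (\<theta> + l x) * cos (\<eta> + m x) =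
          (cos ((\<theta> - \<eta>) + (l x - m x)) + cos ((\<theta> + \<eta>) + (l x + m x))) / 2" by simp
      then show "c * cos (\<theta> + l x) * (d * cos (\<eta> + m x)) = ?r x"
        by (simp add: field_simps)
    qed
    moreover have "trig_poly L ?r"
      by (rule trig_poly.add; rule trig_poly.wave; rule add_L diff_L; fact)
    ultimately show ?case by (simp only:)
  next
    case (add f g)
    then show ?case using trig_poly.add[OF add.IH] by (simp add: algebra_simps)
  qed
next
  case (add f1 f2)
  then show ?case using trig_poly.add[OF add.IH] by (simp add: algebra_simps)
qed

definition linear_forms :: "((nat \<Rightarrow> real) \<Rightarrow> real) set" where
  "linear_forms = {\<lambda>x. \<Sum>i<n. a i * x i | n a. True}"

lemma linear_formsI: "(\<lambda>x. \<Sum>i<n. a i * x i) \<in> linear_forms"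
  by (auto simp: linear_forms_def)

text \<open>Padding the coefficients with zeros brings two forms of different lengths to a common
  index range, where they can be added.\<close>

lemma linear_forms_pad:
  assumes "l \<in> linear_forms"
  shows "\<exists>n a. \<forall>m\<ge>n. l = (\<lambda>x. \<Sum>i<m. a i * x i)"
proof -
  obtain n and a :: "nat \<Rightarrow> real" where l: "l = (\<lambda>x. \<Sum>i<n. a i * x i)"
    using assms by (auto simp: linear_forms_def)
  show ?thesis
  proof (rule exI[of _ n], rule exI[of _ "\<lambda>i. if i < n then a i else 0"], intro allI impI)
    fix m assume "n \<le> m"
    then show "l = (\<lambda>x. \<Sum>i<m. (if i < n then a i else 0) * x i)"
      unfolding l by (intro ext sum.mono_neutral_cong_left) auto
  qed
qed

lemma linear_forms_closed:
  assumes "l \<in> linear_forms" "m \<in> linear_forms"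
  shows "(\<lambda>x. l x + m x) \<in> linear_forms" "(\<lambda>x. l x - m x) \<in> linear_forms"
proof -
  obtain n a where l: "\<And>k. n \<le> k \<Longrightarrow> l = (\<lambda>x. \<Sum>i<k. a i * x i)"
    using linear_forms_pad[OF assms(1)] by blast
  obtain n' b where m: "\<And>k. n' \<le> k \<Longrightarrow> m = (\<lambda>x. \<Sum>i<k. b i * x i)"
    using linear_forms_pad[OF assms(2)] by blast
  have "(\<lambda>x. l x + m x) = (\<lambda>x. \<Sum>i<max n n'. (a i + b i) * x i)"
    by (subst l[of "max n n'"] m[of "max n n'"]; simp add: sum.distrib distrib_right m[of "max n n'"])
  then show "(\<lambda>x. l x + m x) \<in> linear_forms" using linear_formsI by simp
  have "(\<lambda>x. l x - m x) = (\<lambda>x. \<Sum>i<max n n'. (a i - b i) * x i)"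
    by (subst l[of "max n n'"]; simp add: sum_subtractf left_diff_distrib m[of "max n n'"])
  then show "(\<lambda>x. l x - m x) \<in> linear_forms" using linear_formsI by simp
qed

lemma continuous_imp_borel_measurable_seq:
  fixes f :: "(nat \<Rightarrow> real) \<Rightarrow> real"
  assumes "continuous_on UNIV f" "\<And>i. Y i \<in> borel_measurable M"
  shows "(\<lambda>\<omega>. f (\<lambda>i. Y i \<omega>)) \<in> borel_measurable M"
proof -
  have "(\<lambda>\<omega>. (\<lambda>i. Y i \<omega>)) \<in> borel_measurable M"
    by (rule measurable_coordinatewise_then_product) (rule assms)
  from borel_measurable_continuous_on[OF assms(1) this] show ?thesis .
qed

lemma tendsto_coordinatewise:
  fixes x :: "nat \<Rightarrow> nat \<Rightarrow> real"
  assumes "\<And>i. (\<lambda>k. x k i) \<longlonglongrightarrow> l i"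
  shows "x \<longlonglongrightarrow> l"
proof -
  have "limitin (product_topology (\<lambda>_. euclidean) UNIV) x l sequentially"
    using assms by (simp add: limitin_componentwise)
  then show ?thesis by (simp add: euclidean_product_topology)
qed

text \<open>Since \<open>(sin (s x\<^sub>i) / s)\<^sub>i\<close> stays in a compact cube, on which polynomials are dense, the function
  \<open>f (sin (s x\<^sub>i) / s)\<^sub>i\<close> is a limit of trigonometric polynomials, uniformly on the whole space;
  then let \<open>s\<close> tend to 0.\<close>

lemma integral_eq_if_waves_eq:
  fixes f :: "(nat \<Rightarrow> real) \<Rightarrow> real"
  assumes "prob_space M" "prob_space N"
    and Y [measurable]: "\<And>i. Y i \<in> borel_measurable M"
    and Z [measurable]: "\<And>i. Z i \<in> borel_measurable N"
    and waves: "\<And>n a \<theta>. (\<integral>\<omega>. cos (\<theta> + (\<Sum>i<n. a i * Y i \<omega>)) \<partial>M) =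
        (\<integral>\<omega>. cos (\<theta> + (\<Sum>i<n. a i * Z i \<omega>)) \<partial>N)"
    and cont: "continuous_on UNIV f" and bdd: "\<And>x. \<bar>f x\<bar> \<le> B"
  shows "(\<integral>\<omega>. f (\<lambda>i. Y i \<omega>) \<partial>M) = (\<integral>\<omega>. f (\<lambda>i. Z i \<omega>) \<partial>N)"
proof -
  interpret M: prob_space M by fact
  interpret N: prob_space N by fact
  have trig: "integrable M (\<lambda>\<omega>. p (\<lambda>i. Y i \<omega>)) \<and> integrable N (\<lambda>\<omega>. p (\<lambda>i. Z i \<omega>)) \<and>
      (\<integral>\<omega>. p (\<lambda>i. Y i \<omega>) \<partial>M) = (\<integral>\<omega>. p (\<lambda>i. Z i \<omega>) \<partial>N)" if "trig_poly linear_forms p" for p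
    using that
  proof induction
    case (wave l c \<theta>)
    then obtain n a where l: "l = (\<lambda>x. \<Sum>i<n. a i * x i)" by (auto simp: linear_forms_def)
    have "integrable M (\<lambda>\<omega>. cos (\<theta> + (\<Sum>i<n. a i * Y i \<omega>)))"
      by (rule M.integrable_const_bound[of _ 1]) auto
    moreover have "integrable N (\<lambda>\<omega>. cos (\<theta> + (\<Sum>i<n. a i * Z i \<omega>)))"
      by (rule N.integrable_const_bound[of _ 1]) auto
    ultimately show ?case using waves[of \<theta> a n] by (simp add: l)
  next
    case (add f g)
    then show ?case by simp
  qed
  define w where "w s x = (\<lambda>i. sin (s * x i) / s)" for s :: real and x :: "nat \<Rightarrow> real"
  have w_cont: "continuous_on UNIV (w s)" for s
    unfolding w_def divide_inverse
    by (intro continuous_on_coordinatewise_then_product continuous_intros) auto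
  have meas: "(\<lambda>\<omega>. f (w s (\<lambda>i. Y i \<omega>))) \<in> borel_measurable M"
    "(\<lambda>\<omega>. f (w s (\<lambda>i. Z i \<omega>))) \<in> borel_measurable N" for s
    by (rule continuous_imp_borel_measurable_seq;
        (rule continuous_on_compose2[OF cont w_cont] | measurable); simp)+
  have eq: "(\<integral>\<omega>. f (w s (\<lambda>i. Y i \<omega>)) \<partial>M) = (\<integral>\<omega>. f (w s (\<lambda>i. Z i \<omega>)) \<partial>N)" if "0 < s" for s
  proof -
    define S where "S = (PiE UNIV (\<lambda>_::nat. {-1/s..1/s}))"
    \<comment> \<open>Continuity is required of \<open>h\<close> itself, the trigonometric form only
      after substituting \<open>w s\<close>. The coordinates lie in \<open>R\<close> and separate
      points, so Stone-Weierstrass applies on the cube \<open>S\<close>.\<close>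
    define R where "R = {h. continuous_on UNIV h \<and> trig_poly linear_forms (\<lambda>x. h (w s x))}"
    have wS: "w s x \<in> S" for x
      using that by (auto simp: S_def w_def PiE_def divide_simps)
    have coord: "(\<lambda>x. x i) \<in> R" for i
    proof -
      \<comment> \<open>The phase -pi/2 turns the cosine into a sine.\<close>
      have "(\<lambda>x. w s x i) = (\<lambda>x. 1 / s * cos (- pi / 2 + (\<Sum>j<Suc i. (if j = i then s else 0) * x j)))"
      proof
        fix x :: "nat \<Rightarrow> real"
        have "(\<Sum>j<Suc i. (if j = i then s else 0) * x j) = s * x i"
          by simp
        then show "w s x i = 1 / s * cos (- pi / 2 + (\<Sum>j<Suc i. (if j = i then s else 0) * x j))"
          by (simp add: w_def cos_diff cos_add)
      qed
      moreover have "trig_poly linear_forms \<dots>" by (rule trig_poly.wave[OF linear_formsI])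
      ultimately have "trig_poly linear_forms (\<lambda>x. w s x i)" by (simp only:)
      then show ?thesis by (simp add: R_def continuous_on_product_coordinates)
    qed
    interpret function_ring_on R S
    proof
      have "compactin (product_topology (\<lambda>_. euclidean) UNIV) S"
        unfolding S_def by (subst compactin_PiE) auto
      then show "compact S" by (simp add: euclidean_product_topology)
    next
      fix h k assume "h \<in> R" "k \<in> R"
      then show "(\<lambda>x. h x + k x) \<in> R" "(\<lambda>x. h x * k x) \<in> R"
        by (auto simp: R_def intro!: continuous_intros trig_poly.add trig_poly_mult linear_forms_closed)
    next
      fix c :: real
      have "trig_poly linear_forms (\<lambda>x. c)"
        using trig_poly.wave[OF linear_formsI[of _ 0], of c 0] by simp
      then show "(\<lambda>_. c) \<in> R" by (simp add: R_def)
    next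
      fix h assume "h \<in> R"
      then show "continuous_on S h" by (auto simp: R_def intro: continuous_on_subset)
    next
      fix x y :: "nat \<Rightarrow> real" assume "x \<noteq> y"
      then obtain i where "x i \<noteq> y i" by auto
      then show "\<exists>h\<in>R. h x \<noteq> h y" by (intro bexI[where x="\<lambda>x. x i"] coord)
    qed
    have "\<bar>(\<integral>\<omega>. f (w s (\<lambda>i. Y i \<omega>)) \<partial>M) - (\<integral>\<omega>. f (w s (\<lambda>i. Z i \<omega>)) \<partial>N)\<bar> \<le> 2 * e" if "0 < e" for e
    proof -
      obtain g where g: "g \<in> R" and fg: "\<And>x. x \<in> S \<Longrightarrow> \<bar>f x - g x\<bar> < e"
        using Stone_Weierstrass_basic[OF continuous_on_subset[OF cont subset_UNIV] \<open>0 < e\<close>] by auto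
      note t = trig[of "\<lambda>x. g (w s x)"]
      have tr: "trig_poly linear_forms (\<lambda>x. g (w s x))" using g by (simp add: R_def)
      have le: "\<bar>f (w s x) - g (w s x)\<bar> \<le> e" for x using fg[OF wS] by (simp add: less_imp_le)
      have iM: "integrable M (\<lambda>\<omega>. f (w s (\<lambda>i. Y i \<omega>)))"
        by (rule M.integrable_const_bound[of _ B]) (auto simp: bdd meas)
      have iN: "integrable N (\<lambda>\<omega>. f (w s (\<lambda>i. Z i \<omega>)))"
        by (rule N.integrable_const_bound[of _ B]) (auto simp: bdd meas)
      have "\<bar>(\<integral>\<omega>. f (w s (\<lambda>i. Y i \<omega>)) - g (w s (\<lambda>i. Y i \<omega>)) \<partial>M)\<bar> \<le> (\<integral>\<omega>. e \<partial>M)"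
        using t[OF tr] iM le by (intro integral_abs_bound[THEN order_trans] integral_mono) auto
      moreover have "\<bar>(\<integral>\<omega>. f (w s (\<lambda>i. Z i \<omega>)) - g (w s (\<lambda>i. Z i \<omega>)) \<partial>N)\<bar> \<le> (\<integral>\<omega>. e \<partial>N)"
        using t[OF tr] iN le by (intro integral_abs_bound[THEN order_trans] integral_mono) auto
      ultimately show ?thesis
        using t[OF tr] iM iN by (simp add: M.prob_space N.prob_space)
    qed
    \<comment> \<open>With e a quarter of the difference, the bound reads difference \<le> half the
      difference, which forces equality.\<close>
    from this[of "\<bar>(\<integral>\<omega>. f (w s (\<lambda>i. Y i \<omega>)) \<partial>M) - (\<integral>\<omega>. f (w s (\<lambda>i. Z i \<omega>)) \<partial>N)\<bar> / 4"]
    show ?thesis by (cases "(\<integral>\<omega>. f (w s (\<lambda>i. Y i \<omega>)) \<partial>M) = (\<integral>\<omega>. f (w s (\<lambda>i. Z i \<omega>)) \<partial>N)") auto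
  qed
  have lim: "(\<lambda>k. f (w (1 / Suc k) x)) \<longlonglongrightarrow> f x" for x
  proof -
    have "(\<lambda>k. w (1 / Suc k) x) \<longlonglongrightarrow> x"
    proof (rule tendsto_coordinatewise)
      fix i
      have "((\<lambda>s. sin (s * x i) / s) \<longlongrightarrow> x i) (at 0)"
      proof -
        have "((\<lambda>s. sin (s * x i)) has_real_derivative x i) (at 0)"
          by (auto intro!: derivative_eq_intros)
        then show ?thesis by (simp add: has_field_derivative_iff)
      qed
      moreover have "filterlim (\<lambda>k. 1 / real (Suc k)) (at 0) sequentially"
        using LIMSEQ_inverse_real_of_nat by (simp add: filterlim_at inverse_eq_divide)
      ultimately show "(\<lambda>k. w (1 / Suc k) x i) \<longlonglongrightarrow> x i"
        unfolding w_def by (rule filterlim_compose)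
    qed
    moreover have "isCont f x" using cont by (simp add: continuous_on_eq_continuous_at)
    ultimately show ?thesis by (rule isCont_tendsto_compose[rotated])
  qed
  have "(\<lambda>k. \<integral>\<omega>. f (w (1 / Suc k) (\<lambda>i. Y i \<omega>)) \<partial>M) \<longlonglongrightarrow> (\<integral>\<omega>. f (\<lambda>i. Y i \<omega>) \<partial>M)"
    by (rule integral_dominated_convergence[where w="\<lambda>_. B"])
       (use lim bdd meas continuous_imp_borel_measurable_seq[OF cont Y] in auto)
  moreover have "(\<lambda>k. \<integral>\<omega>. f (w (1 / Suc k) (\<lambda>i. Z i \<omega>)) \<partial>N) \<longlonglongrightarrow> (\<integral>\<omega>. f (\<lambda>i. Z i \<omega>) \<partial>N)"
    by (rule integral_dominated_convergence[where w="\<lambda>_. B"])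
       (use lim bdd meas continuous_imp_borel_measurable_seq[OF cont Z] in auto)
  ultimately show ?thesis
    using eq by (auto intro: LIMSEQ_unique)
qed

section \<open>Centered Gaussian sequences and their heat semigroup\<close>

lemma centered_gaussian_cases:
  assumes "prob_space M" "gaussian_rv M Z" "integral\<^sup>L M Z = 0"
  shows "(AE \<omega> in M. Z \<omega> = 0) \<or>
    (\<exists>\<sigma>>0. distributed M lborel Z (\<lambda>x. ennreal (normal_density 0 \<sigma> x)))"
proof -
  interpret prob_space M by fact
  from assms(2) consider \<mu> where "AE \<omega> in M. Z \<omega> = \<mu>"
    | \<mu> \<sigma> where "0 < \<sigma>" "distributed M lborel Z (\<lambda>x. ennreal (normal_density \<mu> \<sigma> x))"
    unfolding gaussian_rv_def by blast
  then show ?thesis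
  proof cases
    case 1
    have [measurable]: "Z \<in> borel_measurable M" using assms(2) by (simp add: gaussian_rv_def)
    have "integral\<^sup>L M Z = (\<integral>\<omega>. \<mu> \<partial>M)" using 1 by (intro integral_cong_AE) auto
    then have "\<mu> = 0" using assms(3) by (simp add: prob_space)
    with 1 show ?thesis by simp
  next
    case 2
    then show ?thesis using normal_distributed_expectation[OF 2] assms(3) by auto
  qed
qed

lemma centered_gaussian_integrable_power:
  assumes "prob_space M" "gaussian_rv M Z" "integral\<^sup>L M Z = 0"
  shows "integrable M (\<lambda>\<omega>. \<bar>Z \<omega>\<bar> ^ k)"
  using centered_gaussian_cases[OF assms]
proof (elim disjE exE conjE)
  interpret prob_space M by fact
  have [measurable]: "Z \<in> borel_measurable M" using assms(2) by (simp add: gaussian_rv_def)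
  assume "AE \<omega> in M. Z \<omega> = 0"
  then have "integrable M (\<lambda>\<omega>. \<bar>Z \<omega>\<bar> ^ k) \<longleftrightarrow> integrable M (\<lambda>\<omega>. \<bar>0::real\<bar> ^ k)"
    by (intro integrable_cong_AE) auto
  then show ?thesis by simp
next
  fix \<sigma> :: real
  assume *: "0 < \<sigma>" "distributed M lborel Z (\<lambda>x. ennreal (normal_density 0 \<sigma> x))"
  show ?thesis
    using distributed_integrable[OF *(2), of "\<lambda>x. \<bar>x\<bar> ^ k"] integrable_normal_moment_abs[of \<sigma> 0 k] *(1)
    by simp
qed

text \<open>Real part of iexp \<theta> times the characteristic function. Expressing the variance as
  a second moment gives one formula for the constant and the normal case.\<close>

lemma centered_gaussian_cos:
  assumes "prob_space M" "gaussian_rv M Z" "integral\<^sup>L M Z = 0"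
  shows "(\<integral>\<omega>. cos (\<theta> + c * Z \<omega>) \<partial>M) = cos \<theta> * exp (- (c\<^sup>2 * (\<integral>\<omega>. (Z \<omega>)\<^sup>2 \<partial>M)) / 2)"
  using centered_gaussian_cases[OF assms]
proof (elim disjE exE conjE)
  interpret prob_space M by fact
  have [measurable]: "Z \<in> borel_measurable M" using assms(2) by (simp add: gaussian_rv_def)
  assume ae: "AE \<omega> in M. Z \<omega> = 0"
  have "(\<integral>\<omega>. cos (\<theta> + c * Z \<omega>) \<partial>M) = (\<integral>\<omega>. cos \<theta> \<partial>M)"
    using ae by (intro integral_cong_AE) auto
  moreover have "(\<integral>\<omega>. (Z \<omega>)\<^sup>2 \<partial>M) = (\<integral>\<omega>. 0 \<partial>M)"
    using ae by (intro integral_cong_AE) auto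
  ultimately show ?thesis by (simp add: prob_space)
next
  interpret prob_space M by fact
  fix \<sigma> :: real
  assume *: "0 < \<sigma>" "distributed M lborel Z (\<lambda>x. ennreal (normal_density 0 \<sigma> x))"
  have Zm [measurable]: "Z \<in> borel_measurable M" using assms(2) by (simp add: gaussian_rv_def)
  have var: "(\<integral>\<omega>. (Z \<omega>)\<^sup>2 \<partial>M) = \<sigma>\<^sup>2"
    using normal_distributed_variance[OF *] assms(3) by simp
  \<comment> \<open>The known characteristic function is that of the standard normal law:
    \<open>Z\<close> is divided by \<sigma>, and the frequency becomes c * \<sigma>.\<close>
  have std: "distributed M lborel (\<lambda>\<omega>. Z \<omega> / \<sigma>) std_normal_density"
    using normal_standard_normal_convert[OF *(1), of Z 0] *(2) by simp
  have law: "distr M borel (\<lambda>\<omega>. Z \<omega> / \<sigma>) = std_normal_distribution"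
    using distributed_distr_eq_density[OF std] by (simp cong: distr_cong)
  define t where "t = c * \<sigma>"
  have "(CLINT \<omega>|M. iexp (t * (Z \<omega> / \<sigma>))) = char std_normal_distribution t"
    unfolding law[symmetric] char_def by (subst integral_distr) auto
  then have ch: "(CLINT \<omega>|M. iexp (c * Z \<omega>)) = complex_of_real (exp (- (t\<^sup>2) / 2))"
    using *(1) by (simp add: char_std_normal_distribution t_def field_simps)
  have int: "integrable M (\<lambda>\<omega>. iexp (c * Z \<omega>))"
    by (rule integrable_const_bound[of _ 1]) auto
  have "(CLINT \<omega>|M. iexp \<theta> * iexp (c * Z \<omega>)) = iexp \<theta> * complex_of_real (exp (- (t\<^sup>2) / 2))"
    using ch by simp
  then have "Re (CLINT \<omega>|M. iexp \<theta> * iexp (c * Z \<omega>)) = cos \<theta> * exp (- (t\<^sup>2) / 2)"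
    by (simp add: Re_exp)
  moreover have "Re (CLINT \<omega>|M. iexp \<theta> * iexp (c * Z \<omega>)) = (\<integral>\<omega>. Re (iexp \<theta> * iexp (c * Z \<omega>)) \<partial>M)"
    by (rule integral_Re[symmetric]) (use int in simp)
  moreover have "Re (iexp \<theta> * iexp (c * Z \<omega>)) = cos (\<theta> + c * Z \<omega>)" for \<omega>
    by (simp add: exp_add[symmetric] Re_exp cos_add Im_exp)
  ultimately show ?thesis by (simp add: var t_def power_mult_distrib)
qed

text \<open>Initial segments cover every finite selection of coordinates, since coefficients may
  vanish. Coordinates may coincide, as they do when a grid of times repeats its last point.\<close>

locale centered_gaussian_sequence = prob_space M for M :: "'a measure" +
  fixes Y :: "nat \<Rightarrow> 'a \<Rightarrow> real"
  assumes gaussian_combination: "gaussian_rv M (\<lambda>\<omega>. \<Sum>i<n. a i * Y i \<omega>)"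
    and mean_zero: "integral\<^sup>L M (Y i) = 0"
begin

lemma gaussian_coord: "gaussian_rv M (Y i)"
proof -
  have "(\<lambda>\<omega>. \<Sum>j<Suc i. (if j = i then 1 else 0) * Y j \<omega>) = Y i" by (auto simp: fun_eq_iff)
  then show ?thesis using gaussian_combination[of "\<lambda>j. if j = i then 1 else 0" "Suc i"] by simp
qed

lemma measurable_coord [measurable]: "Y i \<in> borel_measurable M"
  using gaussian_coord by (simp add: gaussian_rv_def)

lemma integrable_abs_power: "integrable M (\<lambda>\<omega>. \<bar>Y i \<omega>\<bar> ^ k)"
  using centered_gaussian_integrable_power[OF prob_space_axioms gaussian_coord mean_zero] .

lemma integrable_coord: "integrable M (Y i)"
  using integrable_abs_power[of i 1] by (simp add: integrable_abs_iff)

lemma mean_combination: "(\<integral>\<omega>. (\<Sum>i<n. a i * Y i \<omega>) \<partial>M) = 0"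
  by (subst Bochner_Integration.integral_sum) (auto simp: integrable_coord mean_zero)

lemma cos_combination:
  "(\<integral>\<omega>. cos (\<theta> + c * (\<Sum>i<n. a i * Y i \<omega>)) \<partial>M) =
     cos \<theta> * exp (- (c\<^sup>2 * (\<integral>\<omega>. (\<Sum>i<n. a i * Y i \<omega>)\<^sup>2 \<partial>M)) / 2)"
  by (rule centered_gaussian_cos[OF prob_space_axioms gaussian_combination mean_combination])

definition heat :: "real \<Rightarrow> ((nat \<Rightarrow> real) \<Rightarrow> real) \<Rightarrow> (nat \<Rightarrow> real) \<Rightarrow> real" where
  "heat h f x = (\<integral>\<omega>. f (\<lambda>i. x i + sqrt h * Y i \<omega>) \<partial>M)"

text \<open>Two independent copies of \<open>Y\<close> live on the product space. The wave
  expectations of sqrt a * Y + sqrt b * Y' pick up a factor exp (- a v / 2) and a factor exp (- b v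
  / 2), with v the second moment of the linear form, just as those of sqrt (a + b) * Y do.\<close>

lemma heat_semigroup:
  assumes "0 \<le> a" "0 \<le> b" and cont: "continuous_on UNIV f" and bdd: "\<And>x. \<bar>f x\<bar> \<le> B"
  shows "heat a (heat b f) x = heat (a + b) f x"
proof -
  interpret P: pair_prob_space M M ..
  define Z where "Z i p = sqrt a * Y i (fst p) + sqrt b * Y i (snd p)" for i p
  have [measurable]: "Z i \<in> borel_measurable (M \<Otimes>\<^sub>M M)" for i
    unfolding Z_def by measurable
  have sh: "continuous_on UNIV (\<lambda>y. f (\<lambda>i. x i + y i))"
    by (rule continuous_on_compose2[OF cont])
       (auto intro!: continuous_on_coordinatewise_then_product continuous_intros
         continuous_on_product_coordinates)
  have "(\<integral>p. f (\<lambda>i. x i + Z i p) \<partial>(M \<Otimes>\<^sub>M M)) = (\<integral>\<omega>. f (\<lambda>i. x i + sqrt (a + b) * Y i \<omega>) \<partial>M)"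
  proof (rule integral_eq_if_waves_eq[OF P.P.prob_space_axioms prob_space_axioms _ _ _ sh bdd])
    fix n \<theta> and c :: "nat \<Rightarrow> real"
    let ?S = "\<lambda>\<omega>. \<Sum>i<n. c i * Y i \<omega>"
    have "(\<integral>p. cos (\<theta> + (\<Sum>i<n. c i * Z i p)) \<partial>(M \<Otimes>\<^sub>M M)) =
        (\<integral>\<omega>. (\<integral>\<omega>'. cos (\<theta> + (\<Sum>i<n. c i * Z i (\<omega>, \<omega>'))) \<partial>M) \<partial>M)"
      by (rule P.integral_fst'[symmetric], rule P.P.integrable_const_bound[of _ 1]) auto
    \<comment> \<open>The outer variable is absorbed into the phase of the inner wave, so
      \<open>cos_combination\<close> can be applied twice.\<close>
    also have "\<dots> = (\<integral>\<omega>. (\<integral>\<omega>'. cos ((\<theta> + sqrt a * ?S \<omega>) + sqrt b * ?S \<omega>') \<partial>M) \<partial>M)"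
      by (simp add: Z_def sum.distrib sum_distrib_left algebra_simps)
    also have "\<dots> = cos \<theta> * exp (- (a * (\<integral>\<omega>. (?S \<omega>)\<^sup>2 \<partial>M)) / 2) * exp (- (b * (\<integral>\<omega>. (?S \<omega>)\<^sup>2 \<partial>M)) / 2)"
      using assms(1,2) by (subst cos_combination) (simp add: cos_combination)
    also have "\<dots> = cos \<theta> * exp (- ((a + b) * (\<integral>\<omega>. (?S \<omega>)\<^sup>2 \<partial>M)) / 2)"
      by (simp add: exp_add[symmetric] field_simps)
    also have "\<dots> = (\<integral>\<omega>. cos (\<theta> + sqrt (a + b) * ?S \<omega>) \<partial>M)"
      using assms(1,2) by (subst cos_combination) simp
    also have "\<dots> = (\<integral>\<omega>. cos (\<theta> + (\<Sum>i<n. c i * (sqrt (a + b) * Y i \<omega>))) \<partial>M)"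
      by (simp add: sum_distrib_left algebra_simps)
    finally show "(\<integral>p. cos (\<theta> + (\<Sum>i<n. c i * Z i p)) \<partial>(M \<Otimes>\<^sub>M M)) = \<dots>" .
  qed auto
  moreover have "(\<integral>p. f (\<lambda>i. x i + Z i p) \<partial>(M \<Otimes>\<^sub>M M)) =
      (\<integral>\<omega>. (\<integral>\<omega>'. f (\<lambda>i. x i + Z i (\<omega>, \<omega>')) \<partial>M) \<partial>M)"
    by (rule P.integral_fst'[symmetric], rule P.P.integrable_const_bound[of _ B])
       (auto simp: bdd intro!: continuous_imp_borel_measurable_seq[OF cont])
  ultimately show ?thesis by (simp add: heat_def Z_def add.assoc)
qed

end

section \<open>Function classes in the first \<open>n\<close> coordinates and their invariance under
  \<open>heat\<close>\<close>

definition l1_lipschitz :: "nat \<Rightarrow> real \<Rightarrow> ((nat \<Rightarrow> real) \<Rightarrow> real) \<Rightarrow> bool" where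
  "l1_lipschitz n L f \<longleftrightarrow> (\<forall>x y. \<bar>f y - f x\<bar> \<le> L * (\<Sum>i<n. \<bar>y i - x i\<bar>))"

lemma l1_lipschitzD: "l1_lipschitz n L f \<Longrightarrow> \<bar>f y - f x\<bar> \<le> L * (\<Sum>i<n. \<bar>y i - x i\<bar>)"
  by (simp add: l1_lipschitz_def)

text \<open>Only finitely many coordinates enter the bound, so \<open>f\<close> depends on these
  alone and is continuous for the product topology.\<close>

lemma l1_lipschitz_continuous:
  assumes "l1_lipschitz n L f"
  shows "continuous_on UNIV f"
proof -
  have "(f \<longlongrightarrow> f x) (at x)" for x
  proof -
    have "((\<lambda>y. L * (\<Sum>i<n. \<bar>y i - x i\<bar>)) \<longlongrightarrow> L * (\<Sum>i<n. \<bar>x i - x i\<bar>)) (at x)"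
    proof (intro tendsto_intros)
      fix i
      show "((\<lambda>y. y i) \<longlongrightarrow> x i) (at x)"
        using continuous_on_product_coordinates[of i, where ?'b = real] by (auto simp: continuous_on_def)
    qed
    then have "((\<lambda>y. L * (\<Sum>i<n. \<bar>y i - x i\<bar>)) \<longlongrightarrow> 0) (at x)" by simp
    then have "((\<lambda>y. f y - f x) \<longlongrightarrow> 0) (at x)"
      by (rule Lim_null_comparison[rotated]) (use l1_lipschitzD[OF assms] in simp)
    then show ?thesis by (rule LIM_zero_cancel)
  qed
  then show ?thesis by (simp add: continuous_on_def)
qed

lemma l1_lipschitz_mult:
  assumes "l1_lipschitz n L f" "l1_lipschitz n L g" "\<And>x. \<bar>f x\<bar> \<le> B" "\<And>x. \<bar>g x\<bar> \<le> B"
  shows "l1_lipschitz n (2 * B * L) (\<lambda>x. f x * g x)"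
  unfolding l1_lipschitz_def
proof (intro allI)
  fix x y
  let ?D = "L * (\<Sum>i<n. \<bar>y i - x i\<bar>)"
  have "f y * g y - f x * g x = f y * (g y - g x) + (f y - f x) * g x" by (simp add: algebra_simps)
  then have "\<bar>f y * g y - f x * g x\<bar> \<le> \<bar>f y\<bar> * \<bar>g y - g x\<bar> + \<bar>f y - f x\<bar> * \<bar>g x\<bar>"
    by (metis abs_mult abs_triangle_ineq)
  also have "\<dots> \<le> B * ?D + ?D * B"
    using assms(3)[of y] assms(4)[of x] l1_lipschitzD[OF assms(1), of y x] l1_lipschitzD[OF assms(2), of y x]
    by (intro add_mono mult_mono) auto
  finally show "\<bar>f y * g y - f x * g x\<bar> \<le> 2 * B * L * (\<Sum>i<n. \<bar>y i - x i\<bar>)"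
    by (simp add: algebra_simps)
qed

text \<open>Integrated form of "\<open>f\<close> has a nonnegative, Lipschitz gradient
  \<open>d\<close>". Every clause is linear or a bound invariant under translation, so it passes
  through an expectation. A single \<open>C\<close> controls all clauses, so that one constant
  describes the class kept by the semigroup.\<close>

definition smooth_increasing :: "nat \<Rightarrow> real \<Rightarrow> ((nat \<Rightarrow> real) \<Rightarrow> real) \<Rightarrow> bool" where
  "smooth_increasing n C f \<longleftrightarrow> (\<forall>x. \<bar>f x\<bar> \<le> C) \<and> l1_lipschitz n C f \<and>
     (\<exists>d. (\<forall>i. d i \<in> borel_measurable borel) \<and> (\<forall>i x. 0 \<le> d i x \<and> d i x \<le> C) \<and>
       (\<forall>x y. \<bar>f y - f x - (\<Sum>i<n. d i x * (y i - x i))\<bar> \<le> C * (\<Sum>i<n. \<bar>y i - x i\<bar>)\<^sup>2))"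

context centered_gaussian_sequence
begin

lemma integrable_comp:
  assumes "f \<in> borel_measurable borel" "\<And>x. \<bar>f x\<bar> \<le> (B::real)"
  shows "integrable M (\<lambda>\<omega>. f (\<lambda>i. x i + c * Y i \<omega>))"
proof (rule integrable_const_bound[of _ B])
  have "(\<lambda>\<omega>. \<lambda>i. x i + c * Y i \<omega>) \<in> borel_measurable M"
    by (rule measurable_coordinatewise_then_product) measurable
  then show "(\<lambda>\<omega>. f (\<lambda>i. x i + c * Y i \<omega>)) \<in> borel_measurable M"
    using assms(1) by (rule measurable_compose)
qed (auto simp: assms)

lemma integrable_comp_lipschitz:
  assumes "l1_lipschitz n L f" "\<And>x. \<bar>f x\<bar> \<le> B"
  shows "integrable M (\<lambda>\<omega>. f (\<lambda>i. x i + c * Y i \<omega>))"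
  using l1_lipschitz_continuous[OF assms(1)] assms(2)
  by (intro integrable_comp borel_measurable_continuous_onI) auto

lemma heat_bounded:
  assumes "f \<in> borel_measurable borel" "\<And>x. \<bar>f x\<bar> \<le> B"
  shows "\<bar>heat h f x\<bar> \<le> B"
proof -
  have "\<bar>heat h f x\<bar> \<le> (\<integral>\<omega>. B \<partial>M)"
    unfolding heat_def
    by (intro integral_abs_bound[THEN order_trans] integral_mono integrable_abs integrable_comp[OF assms])
       (auto simp: assms(2))
  then show ?thesis by (simp add: prob_space)
qed

lemma heat_lipschitz:
  assumes "l1_lipschitz n L f" "\<And>x. \<bar>f x\<bar> \<le> B"
  shows "l1_lipschitz n L (heat h f)"
  unfolding l1_lipschitz_def
proof (intro allI)
  fix x y
  note i = integrable_comp_lipschitz[OF assms]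
  have "\<bar>heat h f y - heat h f x\<bar> =
      \<bar>\<integral>\<omega>. f (\<lambda>i. y i + sqrt h * Y i \<omega>) - f (\<lambda>i. x i + sqrt h * Y i \<omega>) \<partial>M\<bar>"
    unfolding heat_def by (simp add: i)
  also have "\<dots> \<le> (\<integral>\<omega>. L * (\<Sum>i<n. \<bar>y i - x i\<bar>) \<partial>M)"
  proof (intro integral_abs_bound[THEN order_trans] integral_mono integrable_abs Bochner_Integration.integrable_diff i)
    fix \<omega>
    show "\<bar>f (\<lambda>i. y i + sqrt h * Y i \<omega>) - f (\<lambda>i. x i + sqrt h * Y i \<omega>)\<bar> \<le> L * (\<Sum>i<n. \<bar>y i - x i\<bar>)"
      using l1_lipschitzD[OF assms(1), of "\<lambda>i. y i + sqrt h * Y i \<omega>" "\<lambda>i. x i + sqrt h * Y i \<omega>"] by simp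
  qed simp
  finally show "\<bar>heat h f y - heat h f x\<bar> \<le> L * (\<Sum>i<n. \<bar>y i - x i\<bar>)" by (simp add: prob_space)
qed

text \<open>The gradient of \<open>heat h f\<close> is \<open>heat h (d i)\<close>: the Taylor
  inequality is integrated over the shifted points. Its remainder depends only on y - x, and the
  total mass is 1, so \<open>C\<close> does not grow.\<close>

lemma heat_smooth_increasing:
  assumes "smooth_increasing n C f"
  shows "smooth_increasing n C (heat h f)"
proof -
  obtain d where d: "\<And>i. d i \<in> borel_measurable borel" "\<And>i x. 0 \<le> d i x" "\<And>i x. d i x \<le> C"
      "\<And>x y. \<bar>f y - f x - (\<Sum>i<n. d i x * (y i - x i))\<bar> \<le> C * (\<Sum>i<n. \<bar>y i - x i\<bar>)\<^sup>2"
    and bdd: "\<And>x. \<bar>f x\<bar> \<le> C" and lip: "l1_lipschitz n C f"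
    using assms unfolding smooth_increasing_def by blast
  have fm: "f \<in> borel_measurable borel"
    using l1_lipschitz_continuous[OF lip] by (rule borel_measurable_continuous_onI)
  have di: "\<bar>d i x\<bar> \<le> C" for i x using d(2,3)[of i x] by simp
  note int_d = integrable_comp[OF d(1) di]
  note int_f = integrable_comp_lipschitz[OF lip bdd]
  define e where "e i = heat h (d i)" for i
  \<comment> \<open>Joint measurability in the starting point and \<omega>, then integration over
    \<omega>.\<close>
  have "e i \<in> borel_measurable borel" for i
  proof -
    have "(\<lambda>p. (\<lambda>j. fst p j + sqrt h * Y j (snd p))) \<in> borel_measurable (borel \<Otimes>\<^sub>M M)"
    proof (rule measurable_coordinatewise_then_product)
      fix j :: nat
      have [measurable]: "(\<lambda>x::nat \<Rightarrow> real. x j) \<in> borel_measurable borel" by simp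
      show "(\<lambda>p. fst p j + sqrt h * Y j (snd p)) \<in> borel_measurable (borel \<Otimes>\<^sub>M M)"
        by measurable
    qed
    from measurable_compose[OF this d(1)[of i]]
    have "(\<lambda>(x, \<omega>). d i (\<lambda>j. x j + sqrt h * Y j \<omega>)) \<in> borel_measurable (borel \<Otimes>\<^sub>M M)"
      by (simp add: case_prod_beta')
    then show ?thesis unfolding e_def heat_def by (rule borel_measurable_lebesgue_integral)
  qed
  moreover have "0 \<le> e i x \<and> e i x \<le> C" for i x
    using heat_bounded[OF d(1) di, of h i x] d(2)
    by (auto simp: e_def heat_def intro!: Bochner_Integration.integral_nonneg)
  moreover have "\<bar>heat h f y - heat h f x - (\<Sum>i<n. e i x * (y i - x i))\<bar> \<le> C * (\<Sum>i<n. \<bar>y i - x i\<bar>)\<^sup>2" for x y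
  proof -
    let ?s = "\<lambda>x \<omega> i. x i + sqrt h * Y i \<omega>"
    have "heat h f y - heat h f x - (\<Sum>i<n. e i x * (y i - x i)) =
       (\<integral>\<omega>. f (?s y \<omega>) - f (?s x \<omega>) - (\<Sum>i<n. d i (?s x \<omega>) * (y i - x i)) \<partial>M)"
      unfolding heat_def e_def using int_d int_f by simp
    also have "\<bar>\<dots>\<bar> \<le> (\<integral>\<omega>. C * (\<Sum>i<n. \<bar>y i - x i\<bar>)\<^sup>2 \<partial>M)"
    proof (intro integral_abs_bound[THEN order_trans] integral_mono)
      show "integrable M (\<lambda>\<omega>. \<bar>f (?s y \<omega>) - f (?s x \<omega>) - (\<Sum>i<n. d i (?s x \<omega>) * (y i - x i))\<bar>)"
        using int_d int_f by simp
      show "\<bar>f (?s y \<omega>) - f (?s x \<omega>) - (\<Sum>i<n. d i (?s x \<omega>) * (y i - x i))\<bar>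
          \<le> C * (\<Sum>i<n. \<bar>y i - x i\<bar>)\<^sup>2" for \<omega>
        using d(4)[of "?s y \<omega>" "?s x \<omega>"] by simp
    qed simp
    finally show ?thesis by (simp add: prob_space)
  qed
  ultimately show ?thesis
    unfolding smooth_increasing_def
    using heat_bounded[OF fm bdd] heat_lipschitz[OF lip bdd] by blast
qed

section \<open>Moments, and covariances under the semigroup for short and for unit time\<close>

lemma integrable_l1_power: "integrable M (\<lambda>\<omega>. (\<Sum>i<n. \<bar>Y i \<omega>\<bar>) ^ k)"
proof (induction n)
  case 0
  show ?case by simp
next
  case (Suc n)
  \<comment> \<open>Splitting off one coordinate at a time reduces the claim to the absolute moments
    of single coordinates.\<close>
  have le: "(s + a) ^ k \<le> 2 ^ k * (s ^ k + a ^ k)" if "0 \<le> s" "0 \<le> a" for s a :: real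
  proof -
    have "(s + a) ^ k \<le> (2 * max s a) ^ k" using that by (intro power_mono) auto
    also have "\<dots> = 2 ^ k * max s a ^ k" by (simp add: power_mult_distrib)
    also have "\<dots> \<le> 2 ^ k * (s ^ k + a ^ k)"
      using that by (intro mult_left_mono) (auto simp: max_def)
    finally show ?thesis .
  qed
  show ?case
  proof (rule Bochner_Integration.integrable_bound)
    show "integrable M (\<lambda>\<omega>. 2 ^ k * ((\<Sum>i<n. \<bar>Y i \<omega>\<bar>) ^ k + \<bar>Y n \<omega>\<bar> ^ k))"
      using Suc integrable_abs_power by simp
    show "AE \<omega> in M. norm ((\<Sum>i<Suc n. \<bar>Y i \<omega>\<bar>) ^ k)
        \<le> norm (2 ^ k * ((\<Sum>i<n. \<bar>Y i \<omega>\<bar>) ^ k + \<bar>Y n \<omega>\<bar> ^ k))"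
      using le by (intro AE_I2) (simp add: sum_nonneg)
  qed measurable
qed

lemma integrable_coord_mult: "integrable M (\<lambda>\<omega>. Y i \<omega> * Y j \<omega>)"
proof (rule Bochner_Integration.integrable_bound)
  show "integrable M (\<lambda>\<omega>. \<bar>Y i \<omega>\<bar> ^ 2 + \<bar>Y j \<omega>\<bar> ^ 2)"
    by (intro Bochner_Integration.integrable_add integrable_abs_power)
  show "AE \<omega> in M. norm (Y i \<omega> * Y j \<omega>) \<le> norm (\<bar>Y i \<omega>\<bar> ^ 2 + \<bar>Y j \<omega>\<bar> ^ 2)"
  proof (intro AE_I2)
    fix \<omega>
    have "2 * \<bar>Y i \<omega> * Y j \<omega>\<bar> \<le> \<bar>Y i \<omega>\<bar> ^ 2 + \<bar>Y j \<omega>\<bar> ^ 2"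
      using sum_squares_bound[of "\<bar>Y i \<omega>\<bar>" "\<bar>Y j \<omega>\<bar>"] by (simp only: abs_mult mult.assoc)
    then show "norm (Y i \<omega> * Y j \<omega>) \<le> norm (\<bar>Y i \<omega>\<bar> ^ 2 + \<bar>Y j \<omega>\<bar> ^ 2)"
      unfolding real_norm_def by linarith
  qed
qed measurable

text \<open>Here the sign of the covariances enters: the product expands into a double sum with
  weights \<open>a i * b j\<close>, which are nonnegative because increasing functions have
  nonnegative gradients.\<close>

lemma integral_combination_mult_nonneg:
  assumes cov: "\<And>i j. 0 \<le> (\<integral>\<omega>. Y i \<omega> * Y j \<omega> \<partial>M)"
    and "\<And>i. 0 \<le> a i" "\<And>i. 0 \<le> b i"
  shows "integrable M (\<lambda>\<omega>. (\<Sum>i<n. a i * Y i \<omega>) * (\<Sum>i<n. b i * Y i \<omega>))"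
    and "0 \<le> (\<integral>\<omega>. (\<Sum>i<n. a i * Y i \<omega>) * (\<Sum>i<n. b i * Y i \<omega>) \<partial>M)"
proof -
  have eq: "(\<Sum>i<n. a i * Y i \<omega>) * (\<Sum>i<n. b i * Y i \<omega>) =
      (\<Sum>i<n. \<Sum>j<n. a i * b j * (Y i \<omega> * Y j \<omega>))" for \<omega>
    by (simp add: sum_product algebra_simps)
  show "integrable M (\<lambda>\<omega>. (\<Sum>i<n. a i * Y i \<omega>) * (\<Sum>i<n. b i * Y i \<omega>))"
    unfolding eq using integrable_coord_mult by simp
  show "0 \<le> (\<integral>\<omega>. (\<Sum>i<n. a i * Y i \<omega>) * (\<Sum>i<n. b i * Y i \<omega>) \<partial>M)"
    unfolding eq using integrable_coord_mult assms by (simp add: sum_nonneg)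
qed

text \<open>To first order in \<open>h\<close> the covariance is \<open>h (\<Sum>i j. d i * e j * E (Y i * Y j))\<close>, where \<open>d\<close> and \<open>e\<close> are
  the gradients of \<open>f\<close> and \<open>g\<close>.\<close>

lemma heat_mult_small_time:
  fixes n :: nat and C :: real
  assumes cov: "\<And>i j. 0 \<le> (\<integral>\<omega>. Y i \<omega> * Y j \<omega> \<partial>M)"
  obtains K where "0 \<le> K" "\<And>f g h x. smooth_increasing n C f \<Longrightarrow> smooth_increasing n C g \<Longrightarrow> 0 \<le> h \<Longrightarrow> h \<le> 1 \<Longrightarrow>
     heat h f x * heat h g x - K * (h * sqrt h) \<le> heat h (\<lambda>x. f x * g x) x"
proof -
  define R where "R \<omega> = (\<Sum>i<n. \<bar>Y i \<omega>\<bar>)" for \<omega>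
  \<comment> \<open>One integrable majorant for all powers of \<open>R\<close> up to the fourth, the
    highest that the product of two quadratic remainders produces.\<close>
  define W where "W \<omega> = 1 + R \<omega> ^ 4" for \<omega>
  define m where "m = (\<integral>\<omega>. W \<omega> \<partial>M)"
  have R0: "0 \<le> R \<omega>" for \<omega> by (simp add: R_def sum_nonneg)
  have W_int: "integrable M W" unfolding W_def R_def using integrable_l1_power by simp
  have RW: "R \<omega> ^ k \<le> W \<omega>" if "k \<le> 4" for \<omega> k
  proof (cases "R \<omega> \<le> 1")
    case True
    then have "R \<omega> ^ k \<le> 1" using R0 by (simp add: power_le_one)
    also have "\<dots> \<le> W \<omega>" using R0 by (simp add: W_def)
    finally show ?thesis .
  next
    case False
    then have "R \<omega> ^ k \<le> R \<omega> ^ 4" using that by (intro power_increasing) auto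
    then show ?thesis by (simp add: W_def)
  qed
  have m0: "0 \<le> m" unfolding m_def using R0 by (intro Bochner_Integration.integral_nonneg) (simp add: W_def)
  show thesis
  \<comment> \<open>The three remainder products a * s, r * b and r * s cost C^2 * m each, and the
    product of the two means costs C^2 * m^2. Terms of order h^2 are absorbed because h \<le> 1.
    Nothing here depends on \<open>f\<close>, \<open>g\<close> or \<open>x\<close>, as the iteration
    requires.\<close>
  proof (rule that[of "3 * C\<^sup>2 * m + C\<^sup>2 * m\<^sup>2"])
    fix f g :: "(nat \<Rightarrow> real) \<Rightarrow> real" and h :: real and x :: "nat \<Rightarrow> real"
    assume f: "smooth_increasing n C f" and g: "smooth_increasing n C g" and h: "0 \<le> h" "h \<le> 1"
    obtain d where d: "\<And>i x. 0 \<le> d i x" "\<And>i x. d i x \<le> C"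
        "\<And>x y. \<bar>f y - f x - (\<Sum>i<n. d i x * (y i - x i))\<bar> \<le> C * (\<Sum>i<n. \<bar>y i - x i\<bar>)\<^sup>2"
      and fb: "\<And>x. \<bar>f x\<bar> \<le> C" and fl: "l1_lipschitz n C f"
      using f unfolding smooth_increasing_def by blast
    obtain e where e: "\<And>i x. 0 \<le> e i x" "\<And>i x. e i x \<le> C"
        "\<And>x y. \<bar>g y - g x - (\<Sum>i<n. e i x * (y i - x i))\<bar> \<le> C * (\<Sum>i<n. \<bar>y i - x i\<bar>)\<^sup>2"
      and gb: "\<And>x. \<bar>g x\<bar> \<le> C" and gl: "l1_lipschitz n C g"
      using g unfolding smooth_increasing_def by blast
    have C0: "0 \<le> C" using fb[of x] by simp
    have hs: "0 \<le> sqrt h" "sqrt h \<le> 1" "sqrt h * sqrt h = h" "h * h \<le> h * sqrt h"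
      using h real_le_rsqrt[of h h] mult_left_mono[of h "sqrt h" h]
      by (auto simp: power2_eq_square mult_le_cancel_left1 mult_left_le)
    define a where "a \<omega> = (\<Sum>i<n. d i x * Y i \<omega>)" for \<omega>
    define b where "b \<omega> = (\<Sum>i<n. e i x * Y i \<omega>)" for \<omega>
    define u where "u \<omega> = f (\<lambda>i. x i + sqrt h * Y i \<omega>) - f x" for \<omega>
    define v where "v \<omega> = g (\<lambda>i. x i + sqrt h * Y i \<omega>) - g x" for \<omega>
    \<comment> \<open>Taylor remainders: of order h, while the linear parts
      \<open>sqrt h * a\<close> and \<open>sqrt h * b\<close> are of order sqrt h.\<close>
    define r where "r \<omega> = u \<omega> - sqrt h * a \<omega>" for \<omega>
    define s where "s \<omega> = v \<omega> - sqrt h * b \<omega>" for \<omega>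
    have scale: "(\<Sum>i<n. \<bar>x i + sqrt h * Y i \<omega> - x i\<bar>) = sqrt h * R \<omega>" for \<omega>
      using h by (simp add: R_def abs_mult sum_distrib_left)
    have r_le: "\<bar>r \<omega>\<bar> \<le> C * h * R \<omega> ^ 2" for \<omega>
      using d(3)[of "\<lambda>i. x i + sqrt h * Y i \<omega>" x] h unfolding scale
      by (simp add: r_def u_def a_def sum_distrib_left power_mult_distrib algebra_simps)
    have s_le: "\<bar>s \<omega>\<bar> \<le> C * h * R \<omega> ^ 2" for \<omega>
      using e(3)[of "\<lambda>i. x i + sqrt h * Y i \<omega>" x] h unfolding scale
      by (simp add: s_def v_def b_def sum_distrib_left power_mult_distrib algebra_simps)
    have a_le: "\<bar>a \<omega>\<bar> \<le> C * R \<omega>" for \<omega>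
      unfolding a_def R_def sum_distrib_left
      by (rule sum_abs[THEN order_trans], rule sum_mono) (simp add: abs_mult d mult_right_mono)
    have b_le: "\<bar>b \<omega>\<bar> \<le> C * R \<omega>" for \<omega>
      unfolding b_def R_def sum_distrib_left
      by (rule sum_abs[THEN order_trans], rule sum_mono) (simp add: abs_mult e mult_right_mono)
    have uv: "h * (a \<omega> * b \<omega>) - 3 * C\<^sup>2 * (h * sqrt h) * W \<omega> \<le> u \<omega> * v \<omega>" for \<omega>
    proof -
      have eq: "u \<omega> * v \<omega> = h * (a \<omega> * b \<omega>) + sqrt h * (a \<omega> * s \<omega>) + sqrt h * (r \<omega> * b \<omega>) + r \<omega> * s \<omega>"
      proof -
        have "u \<omega> * v \<omega> = (sqrt h * a \<omega> + r \<omega>) * (sqrt h * b \<omega> + s \<omega>)" by (simp add: r_def s_def)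
        also have "\<dots> = (sqrt h * sqrt h) * (a \<omega> * b \<omega>) + sqrt h * (a \<omega> * s \<omega>) + sqrt h * (r \<omega> * b \<omega>) + r \<omega> * s \<omega>"
          by (simp only: algebra_simps)
        finally show ?thesis by (simp only: hs(3))
      qed
      have "\<bar>a \<omega> * s \<omega>\<bar> \<le> (C * R \<omega>) * (C * h * R \<omega> ^ 2)"
        unfolding abs_mult using a_le s_le C0 R0 by (intro mult_mono) auto
      also have "\<dots> = C\<^sup>2 * h * R \<omega> ^ 3" by (simp add: power2_eq_square power3_eq_cube)
      also have "\<dots> \<le> C\<^sup>2 * h * W \<omega>" using h by (intro mult_left_mono RW) auto
      finally have 1: "sqrt h * \<bar>a \<omega> * s \<omega>\<bar> \<le> sqrt h * (C\<^sup>2 * h * W \<omega>)"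
        using hs(1) by (rule mult_left_mono)
      have "\<bar>r \<omega> * b \<omega>\<bar> \<le> (C * h * R \<omega> ^ 2) * (C * R \<omega>)"
        unfolding abs_mult using b_le r_le C0 R0 h by (intro mult_mono) auto
      also have "\<dots> = C\<^sup>2 * h * R \<omega> ^ 3" by (simp add: power2_eq_square power3_eq_cube)
      also have "\<dots> \<le> C\<^sup>2 * h * W \<omega>" using h by (intro mult_left_mono RW) auto
      finally have 2: "sqrt h * \<bar>r \<omega> * b \<omega>\<bar> \<le> sqrt h * (C\<^sup>2 * h * W \<omega>)"
        using hs(1) by (rule mult_left_mono)
      have "\<bar>r \<omega> * s \<omega>\<bar> \<le> (C * h * R \<omega> ^ 2) * (C * h * R \<omega> ^ 2)"
        unfolding abs_mult using s_le r_le C0 R0 h by (intro mult_mono) auto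
      also have "\<dots> = C\<^sup>2 * (h * h) * R \<omega> ^ 4" by (simp add: power2_eq_square power4_eq_xxxx)
      also have "\<dots> \<le> C\<^sup>2 * (h * sqrt h) * W \<omega>"
        using h hs(1) R0 by (intro mult_mono[OF mult_left_mono[OF hs(4)] RW]) auto
      finally have 3: "\<bar>r \<omega> * s \<omega>\<bar> \<le> C\<^sup>2 * (h * sqrt h) * W \<omega>" .
      have *: "- (sqrt h * z) \<le> sqrt h * \<bar>z\<bar>" for z
        using mult_left_mono[OF abs_ge_minus_self[of z] hs(1)] by simp
      have "- (sqrt h * (a \<omega> * s \<omega>)) \<le> sqrt h * \<bar>a \<omega> * s \<omega>\<bar>"
        "- (sqrt h * (r \<omega> * b \<omega>)) \<le> sqrt h * \<bar>r \<omega> * b \<omega>\<bar>"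
        by (rule *)+
      moreover have "- (r \<omega> * s \<omega>) \<le> \<bar>r \<omega> * s \<omega>\<bar>" by (rule abs_ge_minus_self)
      ultimately show ?thesis using 1 2 3 unfolding eq by (simp add: algebra_simps)
    qed
    note ifg = integrable_comp_lipschitz[OF l1_lipschitz_mult[OF fl gl fb gb], of "C * C"]
    have fgb: "\<bar>f x * g x\<bar> \<le> C * C" for x unfolding abs_mult using fb gb C0 by (intro mult_mono) auto
    note i = integrable_comp_lipschitz[OF fl fb, of x "sqrt h"] integrable_comp_lipschitz[OF gl gb, of x "sqrt h"]
      ifg[OF fgb, of x "sqrt h"]
    have [simp]: "integrable M u" "integrable M v" unfolding u_def v_def using i by simp_all
    have uv_eq: "u \<omega> * v \<omega> = f (\<lambda>i. x i + sqrt h * Y i \<omega>) * g (\<lambda>i. x i + sqrt h * Y i \<omega>)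
        - g x * f (\<lambda>i. x i + sqrt h * Y i \<omega>) - f x * g (\<lambda>i. x i + sqrt h * Y i \<omega>) + f x * g x" for \<omega>
      by (simp add: u_def v_def algebra_simps)
    have uv_int: "integrable M (\<lambda>\<omega>. u \<omega> * v \<omega>)" unfolding uv_eq using i by simp
    have [simp]: "integrable M a" "integrable M b" unfolding a_def b_def using integrable_coord by simp_all
    have Eu: "(\<integral>\<omega>. u \<omega> \<partial>M) = heat h f x - f x" "(\<integral>\<omega>. v \<omega> \<partial>M) = heat h g x - g x"
      unfolding u_def v_def heat_def using i by (simp_all add: prob_space)
    have "(\<integral>\<omega>. u \<omega> * v \<omega> \<partial>M) = heat h (\<lambda>x. f x * g x) x - g x * heat h f x - f x * heat h g x + f x * g x"
      unfolding uv_eq heat_def using i by (simp add: prob_space)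
    \<comment> \<open>Subtracting the constants \<open>f x\<close> and \<open>g x\<close> leaves the
      covariance unchanged, so it may be computed from the increments.\<close>
    then have cov_eq: "heat h (\<lambda>x. f x * g x) x - heat h f x * heat h g x =
        (\<integral>\<omega>. u \<omega> * v \<omega> \<partial>M) - (\<integral>\<omega>. u \<omega> \<partial>M) * (\<integral>\<omega>. v \<omega> \<partial>M)"
      unfolding Eu by (simp add: algebra_simps)
    have Eab: "integral\<^sup>L M a = 0" "integral\<^sup>L M b = 0"
      using mean_combination by (simp_all add: a_def[abs_def] b_def[abs_def])
    \<comment> \<open>The linear parts have mean 0, so the mean increments come from the remainders
      alone and are of order h.\<close>
    have "(\<integral>\<omega>. u \<omega> \<partial>M) = (\<integral>\<omega>. r \<omega> \<partial>M)" "(\<integral>\<omega>. v \<omega> \<partial>M) = (\<integral>\<omega>. s \<omega> \<partial>M)"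
      unfolding r_def s_def by (simp_all add: Eab)
    moreover have "\<bar>\<integral>\<omega>. r \<omega> \<partial>M\<bar> \<le> (\<integral>\<omega>. C * h * W \<omega> \<partial>M)" "\<bar>\<integral>\<omega>. s \<omega> \<partial>M\<bar> \<le> (\<integral>\<omega>. C * h * W \<omega> \<partial>M)"
      by (intro integral_abs_bound[THEN order_trans] integral_mono integrable_abs;
          (rule order_trans[OF r_le] order_trans[OF s_le])?;
          use W_int C0 h RW[of 2] in \<open>simp add: r_def s_def mult_left_mono\<close>)+
    ultimately have "\<bar>\<integral>\<omega>. u \<omega> \<partial>M\<bar> \<le> C * h * m" "\<bar>\<integral>\<omega>. v \<omega> \<partial>M\<bar> \<le> C * h * m"
      by (simp_all add: m_def)
    then have "\<bar>(\<integral>\<omega>. u \<omega> \<partial>M) * (\<integral>\<omega>. v \<omega> \<partial>M)\<bar> \<le> (C * h * m) * (C * h * m)"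
      unfolding abs_mult using C0 h m0 by (intro mult_mono) auto
    also have "\<dots> = C\<^sup>2 * m\<^sup>2 * (h * h)" by (simp add: power2_eq_square)
    also have "\<dots> \<le> C\<^sup>2 * m\<^sup>2 * (h * sqrt h)" by (rule mult_left_mono[OF hs(4)]) simp
    finally have 1: "(\<integral>\<omega>. u \<omega> \<partial>M) * (\<integral>\<omega>. v \<omega> \<partial>M) \<le> C\<^sup>2 * m\<^sup>2 * (h * sqrt h)" by simp
    note ab = integral_combination_mult_nonneg[OF cov, of "\<lambda>i. d i x" "\<lambda>i. e i x" n, OF d(1) e(1), folded a_def b_def]
    have "(\<integral>\<omega>. h * (a \<omega> * b \<omega>) - 3 * C\<^sup>2 * (h * sqrt h) * W \<omega> \<partial>M) \<le> (\<integral>\<omega>. u \<omega> * v \<omega> \<partial>M)"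
      using uv uv_int ab(1) W_int by (intro integral_mono) auto
    moreover have "(\<integral>\<omega>. h * (a \<omega> * b \<omega>) - 3 * C\<^sup>2 * (h * sqrt h) * W \<omega> \<partial>M) =
        h * (\<integral>\<omega>. a \<omega> * b \<omega> \<partial>M) - 3 * C\<^sup>2 * (h * sqrt h) * m"
      using ab(1) W_int by (simp add: m_def)
    moreover have "0 \<le> h * (\<integral>\<omega>. a \<omega> * b \<omega> \<partial>M)" using h ab(2) by simp
    ultimately have "- 3 * C\<^sup>2 * (h * sqrt h) * m \<le> (\<integral>\<omega>. u \<omega> * v \<omega> \<partial>M)" by simp
    with 1 cov_eq show "heat h f x * heat h g x - (3 * C\<^sup>2 * m + C\<^sup>2 * m\<^sup>2) * (h * sqrt h) \<le> heat h (\<lambda>x. f x * g x) x"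
      by (simp add: algebra_simps)
  qed (use m0 in simp)
qed

lemma heat_mult_smooth_increasing:
  assumes cov: "\<And>i j. 0 \<le> (\<integral>\<omega>. Y i \<omega> * Y j \<omega> \<partial>M)"
    and f: "smooth_increasing n C f" and g: "smooth_increasing n C g"
  shows "heat 1 f x * heat 1 g x \<le> heat 1 (\<lambda>x. f x * g x) x"
proof -
  obtain K where K: "0 \<le> K" "\<And>f g h x. smooth_increasing n C f \<Longrightarrow> smooth_increasing n C g \<Longrightarrow> 0 \<le> h \<Longrightarrow> h \<le> 1 \<Longrightarrow>
     heat h f x * heat h g x - K * (h * sqrt h) \<le> heat h (\<lambda>x. f x * g x) x"
    using heat_mult_small_time[OF cov] by blast
  \<comment> \<open>Stated for all \<open>f\<close> and \<open>g\<close> of the class: the doubling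
    step uses the hypothesis both for the original functions and for their images under
    \<open>heat t\<close>.\<close>
  have iter: "heat (2 ^ m * h) f x * heat (2 ^ m * h) g x - 2 ^ m * (K * (h * sqrt h))
      \<le> heat (2 ^ m * h) (\<lambda>x. f x * g x) x"
    if "smooth_increasing n C f" "smooth_increasing n C g" "0 \<le> h" "h \<le> 1" for m h f g x
    using that(1,2)
  proof (induction m arbitrary: f g x)
    case 0
    then show ?case using K(2)[OF 0 that(3,4)] by simp
  next
    case (Suc m)
    define t where "t = 2 ^ m * h"
    define \<delta> where "\<delta> = 2 ^ m * (K * (h * sqrt h))"
    have t: "0 \<le> t" using that by (simp add: t_def)
    have fb: "\<And>x. \<bar>f x\<bar> \<le> C" and fl: "l1_lipschitz n C f" and gb: "\<And>x. \<bar>g x\<bar> \<le> C" and gl: "l1_lipschitz n C g"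
      using Suc.prems by (auto simp: smooth_increasing_def)
    have C0: "0 \<le> C" using fb[of x] by simp
    have fgb: "\<bar>f x * g x\<bar> \<le> C * C" for x unfolding abs_mult using fb gb C0 by (intro mult_mono) auto
    note fgl = l1_lipschitz_mult[OF fl gl fb gb]
    note sm = heat_smooth_increasing[OF Suc.prems(1), of t] heat_smooth_increasing[OF Suc.prems(2), of t]
    have hb: "\<And>x. \<bar>heat t f x\<bar> \<le> C" "\<And>x. \<bar>heat t g x\<bar> \<le> C"
      and hl: "l1_lipschitz n C (heat t f)" "l1_lipschitz n C (heat t g)"
      using sm by (auto simp: smooth_increasing_def)
    have hfgb: "\<bar>heat t f x * heat t g x\<bar> \<le> C * C" for x
      unfolding abs_mult using hb C0 by (intro mult_mono) auto
    have m: "(\<lambda>x. f x * g x) \<in> borel_measurable borel"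
      using l1_lipschitz_continuous[OF fgl] by (rule borel_measurable_continuous_onI)
    have tt: "2 ^ Suc m * h = t + t" by (simp add: t_def)
    have sg: "heat (2 ^ Suc m * h) f x = heat t (heat t f) x" "heat (2 ^ Suc m * h) g x = heat t (heat t g) x"
      "heat (2 ^ Suc m * h) (\<lambda>x. f x * g x) x = heat t (heat t (\<lambda>x. f x * g x)) x"
      unfolding tt
      by (rule heat_semigroup[OF t t l1_lipschitz_continuous[OF fl] fb, symmetric]
          heat_semigroup[OF t t l1_lipschitz_continuous[OF gl] gb, symmetric]
          heat_semigroup[OF t t l1_lipschitz_continuous[OF fgl] fgb, symmetric])+
    \<comment> \<open>First \<delta>: the hypothesis for \<open>heat t f\<close> and
      \<open>heat t g\<close>, which lie in the class with the same \<open>C\<close>.\<close>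
    have "heat t (heat t f) x * heat t (heat t g) x - \<delta> \<le> heat t (\<lambda>x. heat t f x * heat t g x) x"
      unfolding \<delta>_def t_def by (rule Suc.IH) (use sm in \<open>simp_all add: t_def\<close>)
    moreover have "heat t (\<lambda>x. heat t f x * heat t g x) x - \<delta> =
        (\<integral>\<omega>. heat t f (\<lambda>i. x i + sqrt t * Y i \<omega>) * heat t g (\<lambda>i. x i + sqrt t * Y i \<omega>) - \<delta> \<partial>M)"
      using integrable_comp_lipschitz[OF l1_lipschitz_mult[OF hl hb] hfgb, of x "sqrt t"]
      by (subst Bochner_Integration.integral_diff) (auto simp: heat_def[of t "\<lambda>x. heat t f x * heat t g x"] prob_space)
    \<comment> \<open>Second \<delta>: the hypothesis for \<open>f\<close> and \<open>g\<close> at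
      every point, integrated over the outer step.\<close>
    moreover have "\<dots> \<le> (\<integral>\<omega>. heat t (\<lambda>x. f x * g x) (\<lambda>i. x i + sqrt t * Y i \<omega>) \<partial>M)"
    proof (rule integral_mono)
      show "integrable M (\<lambda>\<omega>. heat t f (\<lambda>i. x i + sqrt t * Y i \<omega>) * heat t g (\<lambda>i. x i + sqrt t * Y i \<omega>) - \<delta>)"
        using integrable_comp_lipschitz[OF l1_lipschitz_mult[OF hl hb] hfgb, of x "sqrt t"] by simp
      show "integrable M (\<lambda>\<omega>. heat t (\<lambda>x. f x * g x) (\<lambda>i. x i + sqrt t * Y i \<omega>))"
        by (rule integrable_comp_lipschitz[OF heat_lipschitz[OF fgl fgb] heat_bounded[OF m fgb]])
      show "heat t f y * heat t g y - \<delta> \<le> heat t (\<lambda>x. f x * g x) y" for y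
        unfolding \<delta>_def t_def by (rule Suc.IH[OF Suc.prems])
    qed
    ultimately have "heat t (heat t f) x * heat t (heat t g) x - 2 * \<delta> \<le> heat t (heat t (\<lambda>x. f x * g x)) x"
      by (simp add: heat_def[of t "heat t (\<lambda>x. f x * g x)"])
    then show ?case unfolding sg by (simp add: \<delta>_def)
  qed
  \<comment> \<open>With h = 2^-m the total time is 1 and the error 2^m * K * h * sqrt h equals K *
    sqrt h.\<close>
  have "heat 1 f x * heat 1 g x - K * sqrt ((1 / 2) ^ m) \<le> heat 1 (\<lambda>x. f x * g x) x" for m
    using iter[OF f g, of "(1 / 2) ^ m" m x] by (simp add: power_le_one power_one_over)
  moreover have "(\<lambda>m. heat 1 f x * heat 1 g x - K * sqrt ((1 / 2) ^ m)) \<longlonglongrightarrow> heat 1 f x * heat 1 g x - K * sqrt 0"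
    by (intro tendsto_intros LIMSEQ_power_zero) simp
  ultimately show ?thesis
    by (auto intro: LIMSEQ_le_const2)
qed

end

section \<open>Smoothing by averaging in each coordinate\<close>

definition avg :: "real \<Rightarrow> nat \<Rightarrow> ((nat \<Rightarrow> real) \<Rightarrow> real) \<Rightarrow> (nat \<Rightarrow> real) \<Rightarrow> real" where
  "avg \<epsilon> j f x = integral {0..\<epsilon>} (\<lambda>u. f (x(j := x j + u))) / \<epsilon>"

lemma continuous_on_shift_coord:
  assumes "l1_lipschitz n L f"
  shows "continuous_on S (\<lambda>u. f (x(j := x j + u)))"
proof -
  have "continuous_on S (\<lambda>u. x(j := x j + u))"
  proof (rule continuous_on_coordinatewise_then_product)
    show "continuous_on S (\<lambda>u. (x(j := x j + u)) i)" for i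
      by (cases "i = j") (auto intro!: continuous_intros)
  qed
  from continuous_on_compose2[OF l1_lipschitz_continuous[OF assms] this] show ?thesis by simp
qed

text \<open>Common source of the bounds on averages: \<open>g\<close> = 0 gives the sup bound (c =
  0) and the approximation error (c = f x), and \<open>g\<close> = \<open>f\<close> at another point
  gives the Lipschitz bound.\<close>

lemma avg_diff_le:
  assumes "l1_lipschitz n L f" "l1_lipschitz n' L' g" "0 < \<epsilon>"
    and "\<And>u. 0 \<le> u \<Longrightarrow> u \<le> \<epsilon> \<Longrightarrow> \<bar>f (x(j := x j + u)) - g (y(j := y j + u)) - c\<bar> \<le> D"
  shows "\<bar>avg \<epsilon> j f x - avg \<epsilon> j g y - c\<bar> \<le> D"
proof -
  note i = integrable_continuous_real[OF continuous_on_shift_coord[OF assms(1), where x = x and j = j], of 0 \<epsilon>]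
    integrable_continuous_real[OF continuous_on_shift_coord[OF assms(2), where x = y and j = j], of 0 \<epsilon>]
  have "integral {0..\<epsilon>} (\<lambda>u. f (x(j := x j + u)) - g (y(j := y j + u)) - c) =
     integral {0..\<epsilon>} (\<lambda>u. f (x(j := x j + u))) - integral {0..\<epsilon>} (\<lambda>u. g (y(j := y j + u))) - \<epsilon> * c"
    using Henstock_Kurzweil_Integration.integral_diff[OF integrable_diff[OF i] integrable_const_ivl[of c 0 \<epsilon>]]
      Henstock_Kurzweil_Integration.integral_diff[OF i] assms(3) by simp
  then have "avg \<epsilon> j f x - avg \<epsilon> j g y - c =
      integral {0..\<epsilon>} (\<lambda>u. f (x(j := x j + u)) - g (y(j := y j + u)) - c) / \<epsilon>"
    using assms(3) by (simp add: avg_def field_simps)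
  moreover have "norm (integral {0..\<epsilon>} (\<lambda>u. f (x(j := x j + u)) - g (y(j := y j + u)) - c)) \<le> D * (\<epsilon> - 0)"
    by (rule integral_bound)
       (use assms in \<open>auto intro!: continuous_intros continuous_on_shift_coord[OF assms(1)] continuous_on_shift_coord[OF assms(2)]\<close>)
  ultimately show ?thesis using assms(3) by (simp add: pos_divide_le_eq abs_divide)
qed

lemma l1_lipschitz_zero: "l1_lipschitz n 0 (\<lambda>_. 0)"
  by (simp add: l1_lipschitz_def)

lemma avg_zero: "avg \<epsilon> j (\<lambda>_. 0) x = 0"
  by (simp add: avg_def)

lemma avg_bounded:
  assumes "l1_lipschitz n L f" "0 < \<epsilon>" "\<And>x. \<bar>f x\<bar> \<le> B"
  shows "\<bar>avg \<epsilon> j f x\<bar> \<le> B"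
  using avg_diff_le[OF assms(1) l1_lipschitz_zero assms(2), where x = x and y = x and j = j and c = 0 and D = B] assms(3) by (simp add: avg_zero)

lemma avg_lipschitz:
  assumes "l1_lipschitz n L f" "0 < \<epsilon>"
  shows "l1_lipschitz n L (avg \<epsilon> j f)"
  unfolding l1_lipschitz_def
proof (intro allI)
  fix x y
  have "\<bar>f (y(j := y j + u)) - f (x(j := x j + u))\<bar> \<le> L * (\<Sum>i<n. \<bar>y i - x i\<bar>)" for u
  proof -
    have "(\<Sum>i<n. \<bar>(y(j := y j + u)) i - (x(j := x j + u)) i\<bar>) = (\<Sum>i<n. \<bar>y i - x i\<bar>)"
      by (intro sum.cong) auto
    then show ?thesis using l1_lipschitzD[OF assms(1), of "y(j := y j + u)" "x(j := x j + u)"] by (simp only:)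
  qed
  then show "\<bar>avg \<epsilon> j f y - avg \<epsilon> j f x\<bar> \<le> L * (\<Sum>i<n. \<bar>y i - x i\<bar>)"
    using avg_diff_le[OF assms(1,1,2), where x = y and y = x and j = j and c = 0] by simp
qed

lemma avg_mono:
  assumes "l1_lipschitz n L f" "l1_lipschitz n' L' g" "0 < \<epsilon>"
    and "\<And>u. f (x(j := x j + u)) \<le> g (y(j := y j + u))"
  shows "avg \<epsilon> j f x \<le> avg \<epsilon> j g y"
proof -
  have "integral {0..\<epsilon>} (\<lambda>u. f (x(j := x j + u))) \<le> integral {0..\<epsilon>} (\<lambda>u. g (y(j := y j + u)))"
    using assms(4)
    by (intro integral_le integrable_continuous_real continuous_on_shift_coord[OF assms(1)]
        continuous_on_shift_coord[OF assms(2)]) auto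
  then show ?thesis using assms(3) by (simp add: avg_def divide_right_mono)
qed

lemma avg_approx:
  assumes "l1_lipschitz n L f" "0 < \<epsilon>" "0 \<le> L"
  shows "\<bar>avg \<epsilon> j f x - f x\<bar> \<le> L * \<epsilon>"
proof -
  have "\<bar>f (x(j := x j + u)) - 0 - f x\<bar> \<le> L * \<epsilon>" if "0 \<le> u" "u \<le> \<epsilon>" for u
  proof -
    have "(\<Sum>i<n. \<bar>(x(j := x j + u)) i - x i\<bar>) = (\<Sum>i<n. if i = j then \<bar>u\<bar> else 0)"
      by (intro sum.cong) auto
    also have "\<dots> \<le> \<epsilon>" using that by simp
    finally have "L * (\<Sum>i<n. \<bar>(x(j := x j + u)) i - x i\<bar>) \<le> L * \<epsilon>" using assms(3) by (rule mult_left_mono)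
    then show ?thesis using l1_lipschitzD[OF assms(1), of "x(j := x j + u)" x] by simp
  qed
  from avg_diff_le[OF assms(1) l1_lipschitz_zero assms(2) this, where y = x] show ?thesis
    by (simp add: avg_zero)
qed

text \<open>After cancelling the overlap of the two windows, the difference is the integral of
  \<phi> over [\<epsilon>, \<epsilon> + t] minus that over [0, t]. Each short integral is t times
  the value at its left end, up to L * t^2.\<close>

lemma average_increment_nonneg:
  fixes \<phi> :: "real \<Rightarrow> real"
  assumes lip: "\<And>s t. \<bar>\<phi> s - \<phi> t\<bar> \<le> L * \<bar>s - t\<bar>" and "0 < \<epsilon>" "0 \<le> t"
  shows "\<bar>integral {0..\<epsilon>} (\<lambda>u. \<phi> (t + u)) - integral {0..\<epsilon>} \<phi> - t * (\<phi> \<epsilon> - \<phi> 0)\<bar> \<le> 2 * L * t\<^sup>2"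
proof -
  have L0: "0 \<le> L" using lip[of 1 0] by simp
  have cont: "continuous_on S \<phi>" for S
  proof (rule continuous_on_subset[OF _ subset_UNIV])
    have "L-lipschitz_on UNIV \<phi>" using lip L0 by (auto simp: lipschitz_on_def dist_real_def)
    then show "continuous_on UNIV \<phi>" by (rule lipschitz_on_continuous_on)
  qed
  have int: "\<phi> integrable_on {a..b}" for a b by (rule integrable_continuous_real[OF cont])
  have sh: "integral {0..\<epsilon>} (\<lambda>u. \<phi> (t + u)) = integral {t..t + \<epsilon>} \<phi>"
    using integral_shift[of 0 t \<epsilon> \<phi>] cont by (simp add: o_def add.commute)
  have "integral {0..t} \<phi> + integral {t..t + \<epsilon>} \<phi> = integral {0..t + \<epsilon>} \<phi>"
    using assms int by (intro Henstock_Kurzweil_Integration.integral_combine) auto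
  moreover have "integral {0..\<epsilon>} \<phi> + integral {\<epsilon>..t + \<epsilon>} \<phi> = integral {0..t + \<epsilon>} \<phi>"
    using assms int by (intro Henstock_Kurzweil_Integration.integral_combine) auto
  ultimately have eq: "integral {0..\<epsilon>} (\<lambda>u. \<phi> (t + u)) - integral {0..\<epsilon>} \<phi> =
      integral {\<epsilon>..t + \<epsilon>} \<phi> - integral {0..t} \<phi>"
    by (simp add: sh)
  have loc: "\<bar>integral {a..a + t} \<phi> - t * \<phi> a\<bar> \<le> L * t * t" for a
  proof -
    have "norm (integral {a..a + t} (\<lambda>u. \<phi> u - \<phi> a)) \<le> L * t * (a + t - a)"
    proof (rule integral_bound)
      fix u assume "u \<in> {a..a + t}"
      then have "L * \<bar>u - a\<bar> \<le> L * t" using L0 by (intro mult_left_mono) auto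
      then show "norm (\<phi> u - \<phi> a) \<le> L * t" using lip[of u a] by simp
    qed (use assms cont in \<open>auto intro!: continuous_intros\<close>)
    moreover have "integral {a..a + t} (\<lambda>u. \<phi> u - \<phi> a) = integral {a..a + t} \<phi> - t * \<phi> a"
      using assms(3) int by (subst Henstock_Kurzweil_Integration.integral_diff) auto
    ultimately show ?thesis by (simp add: mult.assoc)
  qed
  from loc[of \<epsilon>] loc[of 0] show ?thesis unfolding eq
    by (simp add: add.commute[of t] right_diff_distrib power2_eq_square abs_le_iff)
qed

text \<open>For negative t the base point is moved to t and the positive increment -t is used.
  Moving the difference of \<phi> back from t to 0 costs another 2 * L * t^2, hence the factor
  4.\<close>

lemma average_increment:
  fixes \<phi> :: "real \<Rightarrow> real"
  assumes lip: "\<And>s t. \<bar>\<phi> s - \<phi> t\<bar> \<le> L * \<bar>s - t\<bar>" and "0 < \<epsilon>"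
  shows "\<bar>integral {0..\<epsilon>} (\<lambda>u. \<phi> (t + u)) - integral {0..\<epsilon>} \<phi> - t * (\<phi> \<epsilon> - \<phi> 0)\<bar> \<le> 4 * L * t\<^sup>2"
proof (cases "0 \<le> t")
  case True
  have "0 \<le> L" using lip[of 1 0] by simp
  then have "2 * L * t\<^sup>2 \<le> 4 * L * t\<^sup>2" by (intro mult_right_mono) auto
  with average_increment_nonneg[OF lip assms(2) True] show ?thesis by simp
next
  case False
  have "\<bar>\<phi> (t + s) - \<phi> (t + s')\<bar> \<le> L * \<bar>s - s'\<bar>" for s s' using lip[of "t + s" "t + s'"] by simp
  from average_increment_nonneg[of "\<lambda>u. \<phi> (t + u)", OF this assms(2), of "- t"] False
  have 1: "\<bar>integral {0..\<epsilon>} \<phi> - integral {0..\<epsilon>} (\<lambda>u. \<phi> (t + u)) + t * (\<phi> (t + \<epsilon>) - \<phi> t)\<bar> \<le> 2 * L * t\<^sup>2"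
    by simp
  have "\<bar>\<phi> (t + \<epsilon>) - \<phi> t - (\<phi> \<epsilon> - \<phi> 0)\<bar> \<le> 2 * L * \<bar>t\<bar>"
    using lip[of "t + \<epsilon>" \<epsilon>] lip[of t 0] by (simp add: abs_le_iff)
  then have "\<bar>t\<bar> * \<bar>\<phi> (t + \<epsilon>) - \<phi> t - (\<phi> \<epsilon> - \<phi> 0)\<bar> \<le> \<bar>t\<bar> * (2 * L * \<bar>t\<bar>)"
    by (intro mult_left_mono) auto
  then have 2: "\<bar>t * (\<phi> (t + \<epsilon>) - \<phi> t) - t * (\<phi> \<epsilon> - \<phi> 0)\<bar> \<le> 2 * L * t\<^sup>2"
    unfolding abs_mult[symmetric] by (simp add: power2_eq_square algebra_simps)
  from 1 2 show ?thesis by (simp add: abs_le_iff)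
qed

text \<open>Induction invariant for averaging one coordinate after another: gradients exist in the
  first \<open>k\<close> directions, and the Taylor bound is claimed only for displacements in
  these. The \<open>d i\<close> are Lipschitz because the later averages act on them too.\<close>

definition smooth_upto :: "nat \<Rightarrow> nat \<Rightarrow> real \<Rightarrow> ((nat \<Rightarrow> real) \<Rightarrow> real) \<Rightarrow> bool" where
  "smooth_upto n k C f \<longleftrightarrow> (\<exists>d. (\<forall>i<k. l1_lipschitz n C (d i) \<and> (\<forall>x. 0 \<le> d i x \<and> d i x \<le> C)) \<and>
     (\<forall>x y. (\<forall>i\<ge>k. y i = x i) \<longrightarrow>
        \<bar>f y - f x - (\<Sum>i<k. d i x * (y i - x i))\<bar> \<le> C * (\<Sum>i<n. \<bar>y i - x i\<bar>)\<^sup>2))"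

lemma l1_lipschitz_mono: "l1_lipschitz n L f \<Longrightarrow> L \<le> L' \<Longrightarrow> l1_lipschitz n L' f"
  unfolding l1_lipschitz_def by (meson mult_right_mono order_trans sum_nonneg abs_ge_zero)

lemma smooth_increasing_mono:
  assumes "smooth_increasing n C f" "C \<le> D"
  shows "smooth_increasing n D f"
proof -
  obtain d where d: "\<And>i. d i \<in> borel_measurable borel" "\<And>i x. 0 \<le> d i x \<and> d i x \<le> C"
      "\<And>x y. \<bar>f y - f x - (\<Sum>i<n. d i x * (y i - x i))\<bar> \<le> C * (\<Sum>i<n. \<bar>y i - x i\<bar>)\<^sup>2"
    and bdd: "\<And>x. \<bar>f x\<bar> \<le> C" and lip: "l1_lipschitz n C f"
    using assms(1) unfolding smooth_increasing_def by blast
  have "C * (\<Sum>i<n. \<bar>y i - x i\<bar>)\<^sup>2 \<le> D * (\<Sum>i<n. \<bar>y i - x i\<bar>)\<^sup>2" for x y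
    using assms(2) by (rule mult_right_mono) simp
  then have "\<bar>f y - f x - (\<Sum>i<n. d i x * (y i - x i))\<bar> \<le> D * (\<Sum>i<n. \<bar>y i - x i\<bar>)\<^sup>2" for x y
    using d(3) order_trans by blast
  moreover have "0 \<le> d i x \<and> d i x \<le> D" "\<bar>f x\<bar> \<le> D" for i x
    using d(2)[of i x] bdd[of x] assms(2) by simp_all
  ultimately show ?thesis
    unfolding smooth_increasing_def using d(1) l1_lipschitz_mono[OF lip assms(2)] by blast
qed

text \<open>Averaging in coordinate \<open>k\<close> turns the derivative in that direction into a difference quotient of \<open>f\<close>,
  which is again Lipschitz.\<close>

lemma smooth_upto_avg:
  assumes sm: "smooth_upto n k C f" and "k < n" and lip: "l1_lipschitz n L f" and "0 < \<epsilon>"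
    and mono: "\<And>x y. (\<And>i. x i \<le> y i) \<Longrightarrow> f x \<le> f y" and "0 \<le> C" "0 \<le> L"
  shows "smooth_upto n (Suc k) (C + 6 * L / \<epsilon> + L) (avg \<epsilon> k f)"
proof -
  \<comment> \<open>6 = 4 + 2: \<open>average_increment\<close> contributes 4 * L / \<epsilon>, and
    moving the new partial derivative from \<open>z\<close> back to \<open>x\<close> contributes 2 *
    L / \<epsilon>. The last summand L bounds that derivative itself.\<close>
  let ?C = "C + 6 * L / \<epsilon> + L"
  obtain d where d_lip: "\<And>i. i < k \<Longrightarrow> l1_lipschitz n C (d i)"
    and d_bd: "\<And>i x. i < k \<Longrightarrow> 0 \<le> d i x \<and> d i x \<le> C"
    and d: "\<And>x y. (\<forall>i\<ge>k. y i = x i) \<Longrightarrow>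
        \<bar>f y - f x - (\<Sum>i<k. d i x * (y i - x i))\<bar> \<le> C * (\<Sum>i<n. \<bar>y i - x i\<bar>)\<^sup>2"
    using sm unfolding smooth_upto_def by blast
  define e where "e i = (if i < k then avg \<epsilon> k (d i) else (\<lambda>x. (f (x(k := x k + \<epsilon>)) - f x) / \<epsilon>))" for i
  have C_le: "C \<le> ?C" "2 * L / \<epsilon> \<le> ?C" "L \<le> ?C"
    using assms by (simp_all add: add_nonneg_nonneg divide_right_mono add_increasing add_increasing2)
  have ek_lip: "l1_lipschitz n (2 * L / \<epsilon>) (e k)"
    unfolding l1_lipschitz_def
  proof (intro allI)
    fix x y
    have "(\<Sum>i<n. \<bar>(y(k := y k + \<epsilon>)) i - (x(k := x k + \<epsilon>)) i\<bar>) = (\<Sum>i<n. \<bar>y i - x i\<bar>)"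
      by (intro sum.cong) auto
    then have "\<bar>f (y(k := y k + \<epsilon>)) - f (x(k := x k + \<epsilon>))\<bar> \<le> L * (\<Sum>i<n. \<bar>y i - x i\<bar>)"
      using l1_lipschitzD[OF lip, of "y(k := y k + \<epsilon>)" "x(k := x k + \<epsilon>)"] by (simp only:)
    with l1_lipschitzD[OF lip, of y x]
    have "\<bar>(f (y(k := y k + \<epsilon>)) - f y) - (f (x(k := x k + \<epsilon>)) - f x)\<bar> \<le> 2 * L * (\<Sum>i<n. \<bar>y i - x i\<bar>)"
      by (simp add: abs_le_iff)
    then have "\<bar>(f (y(k := y k + \<epsilon>)) - f y) - (f (x(k := x k + \<epsilon>)) - f x)\<bar> / \<epsilon> \<le> 2 * L * (\<Sum>i<n. \<bar>y i - x i\<bar>) / \<epsilon>"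
      using \<open>0 < \<epsilon>\<close> by (intro divide_right_mono) auto
    then show "\<bar>e k y - e k x\<bar> \<le> 2 * L / \<epsilon> * (\<Sum>i<n. \<bar>y i - x i\<bar>)"
      using \<open>0 < \<epsilon>\<close> by (simp add: e_def diff_divide_distrib[symmetric])
  qed
  have "0 \<le> e k x \<and> e k x \<le> L" for x
  proof -
    have "f x \<le> f (x(k := x k + \<epsilon>))" using \<open>0 < \<epsilon>\<close> by (intro mono) auto
    moreover have "(\<Sum>i<n. \<bar>(x(k := x k + \<epsilon>)) i - x i\<bar>) = (\<Sum>i<n. if i = k then \<epsilon> else 0)"
      using \<open>0 < \<epsilon>\<close> by (intro sum.cong) auto
    then have "\<bar>f (x(k := x k + \<epsilon>)) - f x\<bar> \<le> L * \<epsilon>"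
      using l1_lipschitzD[OF lip, of "x(k := x k + \<epsilon>)" x] \<open>k < n\<close> by simp
    ultimately show ?thesis using \<open>0 < \<epsilon>\<close> by (simp add: e_def divide_simps)
  qed
  moreover have "l1_lipschitz n C (e i)" "0 \<le> e i x \<and> e i x \<le> C" if "i < k" for i x
  proof -
    show "l1_lipschitz n C (e i)" using avg_lipschitz[OF d_lip \<open>0 < \<epsilon>\<close>] that by (simp add: e_def)
    have "0 \<le> avg \<epsilon> k (d i) x"
      using avg_mono[OF l1_lipschitz_zero d_lip[OF that] \<open>0 < \<epsilon>\<close>, of x k x] d_bd[OF that] by (simp add: avg_zero)
    moreover have "\<bar>avg \<epsilon> k (d i) x\<bar> \<le> C"
      using d_bd[OF that] by (intro avg_bounded[OF d_lip[OF that] \<open>0 < \<epsilon>\<close>]) (simp add: abs_le_iff order_trans[OF _ \<open>0 \<le> C\<close>])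
    ultimately show "0 \<le> e i x \<and> e i x \<le> C" using that by (simp add: e_def)
  qed
  ultimately have e_props: "\<forall>i<Suc k. l1_lipschitz n ?C (e i) \<and> (\<forall>x. 0 \<le> e i x \<and> e i x \<le> ?C)"
    using C_le ek_lip by (metis less_Suc_eq l1_lipschitz_mono order_trans)
  moreover have "\<bar>avg \<epsilon> k f y - avg \<epsilon> k f x - (\<Sum>i<Suc k. e i x * (y i - x i))\<bar> \<le> ?C * (\<Sum>i<n. \<bar>y i - x i\<bar>)\<^sup>2"
    if "\<forall>i\<ge>Suc k. y i = x i" for x y
  proof -
    \<comment> \<open>The step from \<open>x\<close> to \<open>z\<close> moves only the first
      \<open>k\<close> coordinates, where the old bound is averaged. The step from \<open>z\<close>
      to \<open>y\<close> moves only coordinate \<open>k\<close>, where the one-dimensional estimate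
      applies.\<close>
    define z where "z = y(k := x k)"
    define t where "t = y k - x k"
    let ?l = "\<Sum>i<n. \<bar>y i - x i\<bar>"
    have zx: "(\<Sum>i<n. \<bar>z i - x i\<bar>) \<le> ?l" by (intro sum_mono) (simp add: z_def)
    have tl: "\<bar>t\<bar> \<le> ?l"
      unfolding t_def using \<open>k < n\<close> by (intro member_le_sum[of k "{..<n}" "\<lambda>i. \<bar>y i - x i\<bar>"]) auto
    have l0: "0 \<le> (\<Sum>i<n. \<bar>z i - x i\<bar>)" by (simp add: sum_nonneg)
    have z_off: "z i = x i" if "k \<le> i" for i
      using that \<open>\<forall>i\<ge>Suc k. y i = x i\<close> by (cases "i = k") (auto simp: z_def)
    have "\<bar>avg \<epsilon> k f z - avg \<epsilon> k f x - (\<Sum>i<k. e i x * (z i - x i))\<bar> \<le> C * (\<Sum>i<n. \<bar>z i - x i\<bar>)\<^sup>2"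
    proof -
      let ?x = "\<lambda>u. x(k := x k + u)" and ?z = "\<lambda>u. z(k := z k + u)"
      have le: "\<bar>f (?z u) - f (?x u) - (\<Sum>i<k. d i (?x u) * (z i - x i))\<bar> \<le> C * (\<Sum>i<n. \<bar>z i - x i\<bar>)\<^sup>2" for u
      proof -
        have "(\<Sum>i<n. \<bar>?z u i - ?x u i\<bar>) = (\<Sum>i<n. \<bar>z i - x i\<bar>)" by (intro sum.cong) auto
        moreover have "(\<Sum>i<k. d i (?x u) * (?z u i - ?x u i)) = (\<Sum>i<k. d i (?x u) * (z i - x i))"
          by (intro sum.cong) auto
        moreover have "\<forall>i\<ge>k. ?z u i = ?x u i" using z_off by simp
        ultimately show ?thesis using d[of "?z u" "?x u"] by (simp only:)
      qed
      have c: "continuous_on S (\<lambda>u. f (?z u))" "continuous_on S (\<lambda>u. f (?x u))" for S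
        by (rule continuous_on_shift_coord[OF lip])+
      have cd: "continuous_on S (\<lambda>u. d i (?x u))" if "i < k" for i S
        by (rule continuous_on_shift_coord[OF d_lip[OF that]])
      have "norm (integral {0..\<epsilon>} (\<lambda>u. f (?z u) - f (?x u) - (\<Sum>i<k. d i (?x u) * (z i - x i)))) \<le>
          C * (\<Sum>i<n. \<bar>z i - x i\<bar>)\<^sup>2 * (\<epsilon> - 0)"
        by (rule integral_bound)
           (use le \<open>0 < \<epsilon>\<close> in \<open>auto intro!: continuous_intros c cd\<close>)
      moreover have "integral {0..\<epsilon>} (\<lambda>u. f (?z u) - f (?x u) - (\<Sum>i<k. d i (?x u) * (z i - x i))) =
          \<epsilon> * (avg \<epsilon> k f z - avg \<epsilon> k f x - (\<Sum>i<k. e i x * (z i - x i)))"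
      proof -
        have "integral {0..\<epsilon>} (\<lambda>u. f (?z u) - f (?x u) - (\<Sum>i<k. d i (?x u) * (z i - x i))) =
          integral {0..\<epsilon>} (\<lambda>u. f (?z u)) - integral {0..\<epsilon>} (\<lambda>u. f (?x u)) -
            (\<Sum>i<k. integral {0..\<epsilon>} (\<lambda>u. d i (?x u)) * (z i - x i))"
          by (subst Henstock_Kurzweil_Integration.integral_diff Henstock_Kurzweil_Integration.integral_sum;
              (intro integrable_continuous_real continuous_intros c cd finite_lessThan)?; simp?)+
        then show ?thesis
          using \<open>0 < \<epsilon>\<close> by (simp add: avg_def e_def right_diff_distrib sum_distrib_left)
      qed
      ultimately show ?thesis using \<open>0 < \<epsilon>\<close> by (simp add: abs_mult)
    qed
    also have "\<dots> \<le> C * ?l\<^sup>2" using zx l0 \<open>0 \<le> C\<close> by (intro mult_left_mono power_mono) auto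
    finally have 1: "\<bar>avg \<epsilon> k f z - avg \<epsilon> k f x - (\<Sum>i<k. e i x * (z i - x i))\<bar> \<le> C * ?l\<^sup>2" .
    have sum_z: "(\<Sum>i<k. e i x * (z i - x i)) = (\<Sum>i<k. e i x * (y i - x i))"
      by (intro sum.cong) (auto simp: z_def)
    have 2: "\<bar>avg \<epsilon> k f y - avg \<epsilon> k f z - t * e k z\<bar> \<le> 4 * L / \<epsilon> * ?l\<^sup>2"
    proof -
      define \<phi> where "\<phi> u = f (z(k := z k + u))" for u
      have lip\<phi>: "\<bar>\<phi> s - \<phi> s'\<bar> \<le> L * \<bar>s - s'\<bar>" for s s'
      proof -
        have "(\<Sum>i<n. \<bar>(z(k := z k + s)) i - (z(k := z k + s')) i\<bar>) = (\<Sum>i<n. if i = k then \<bar>s - s'\<bar> else 0)"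
          by (intro sum.cong) auto
        then show ?thesis
          using l1_lipschitzD[OF lip, of "z(k := z k + s)" "z(k := z k + s')"] \<open>k < n\<close> by (simp add: \<phi>_def)
      qed
      have "y(k := y k + u) = z(k := z k + (t + u))" for u by (simp add: z_def t_def fun_eq_iff)
      then have "avg \<epsilon> k f y = integral {0..\<epsilon>} (\<lambda>u. \<phi> (t + u)) / \<epsilon>" by (simp add: avg_def \<phi>_def)
      moreover have "avg \<epsilon> k f z = integral {0..\<epsilon>} \<phi> / \<epsilon>" by (simp add: avg_def \<phi>_def[abs_def])
      moreover have "e k z = (\<phi> \<epsilon> - \<phi> 0) / \<epsilon>" by (simp add: e_def \<phi>_def)
      ultimately have "avg \<epsilon> k f y - avg \<epsilon> k f z - t * e k z =
          (integral {0..\<epsilon>} (\<lambda>u. \<phi> (t + u)) - integral {0..\<epsilon>} \<phi> - t * (\<phi> \<epsilon> - \<phi> 0)) / \<epsilon>"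
        by (simp add: diff_divide_distrib[symmetric])
      then have "\<bar>avg \<epsilon> k f y - avg \<epsilon> k f z - t * e k z\<bar> \<le> 4 * L * t\<^sup>2 / \<epsilon>"
        using average_increment[of \<phi> L \<epsilon> t, OF lip\<phi> \<open>0 < \<epsilon>\<close>] \<open>0 < \<epsilon>\<close> by (simp add: divide_right_mono)
      also have "\<dots> = 4 * L / \<epsilon> * \<bar>t\<bar>\<^sup>2" by simp
      also have "\<dots> \<le> 4 * L / \<epsilon> * ?l\<^sup>2"
        using tl \<open>0 \<le> L\<close> \<open>0 < \<epsilon>\<close> by (intro mult_left_mono power_mono) auto
      finally show ?thesis .
    qed
    \<comment> \<open>The estimate along coordinate \<open>k\<close> yields the derivative at
      \<open>z\<close>. The Lipschitz bound on \<open>e k\<close> moves it to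
      \<open>x\<close>.\<close>
    have "\<bar>t * e k z - t * e k x\<bar> \<le> 2 * L / \<epsilon> * ?l\<^sup>2"
    proof -
      have "\<bar>t * e k z - t * e k x\<bar> = \<bar>t\<bar> * \<bar>e k z - e k x\<bar>" by (simp add: abs_mult[symmetric] right_diff_distrib)
      also have "\<dots> \<le> ?l * (2 * L / \<epsilon> * (\<Sum>i<n. \<bar>z i - x i\<bar>))"
        using tl l1_lipschitzD[OF ek_lip, of z x] by (intro mult_mono) auto
      also have "\<dots> \<le> ?l * (2 * L / \<epsilon> * ?l)"
        using zx tl \<open>0 \<le> L\<close> \<open>0 < \<epsilon>\<close> by (intro mult_left_mono) auto
      finally show ?thesis by (simp add: power2_eq_square mult_ac)
    qed
    with 1 2 have "\<bar>avg \<epsilon> k f y - avg \<epsilon> k f x - (\<Sum>i<Suc k. e i x * (y i - x i))\<bar> \<le>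
        C * ?l\<^sup>2 + 4 * L / \<epsilon> * ?l\<^sup>2 + 2 * L / \<epsilon> * ?l\<^sup>2"
      unfolding sum_z by (simp add: t_def mult.commute abs_le_iff)
    also have "\<dots> = (C + 6 * L / \<epsilon>) * ?l\<^sup>2" by (simp add: distrib_right add_divide_distrib[symmetric])
    also have "\<dots> \<le> ?C * ?l\<^sup>2" using \<open>0 \<le> L\<close> by (intro mult_right_mono) auto
    finally show ?thesis .
  qed
  ultimately show ?thesis unfolding smooth_upto_def by blast
qed

text \<open>Averaging over the coordinates 0, ..., n - 1 costs L * \<epsilon> each time and keeps
  the sup bound, the Lipschitz constant and monotonicity. No control of \<open>C\<close> as
  \<epsilon> shrinks is claimed: the correlation inequality at time 1 does not contain
  \<open>C\<close>.\<close>

lemma smooth_approximation: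
  assumes lip: "l1_lipschitz n L f" and bdd: "\<And>x. \<bar>f x\<bar> \<le> B"
    and mono: "\<And>x y. (\<And>i. x i \<le> y i) \<Longrightarrow> f x \<le> f y" and "0 \<le> L" "0 < \<epsilon>"
  obtains C g where "smooth_increasing n C g" "\<And>x. \<bar>g x - f x\<bar> \<le> real n * L * \<epsilon>" "\<And>x. \<bar>g x\<bar> \<le> B"
proof -
  have "\<exists>C g. 0 \<le> C \<and> smooth_upto n k C g \<and> l1_lipschitz n L g \<and> (\<forall>x. \<bar>g x\<bar> \<le> B) \<and>
      (\<forall>x y. (\<forall>i. x i \<le> y i) \<longrightarrow> g x \<le> g y) \<and> (\<forall>x. \<bar>g x - f x\<bar> \<le> real k * L * \<epsilon>)" if "k \<le> n" for k
    using that
  proof (induction k)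
    case 0
    \<comment> \<open>For k = 0 the displacement condition forces y = x.\<close>
    have "smooth_upto n 0 0 f"
      unfolding smooth_upto_def by (auto simp: fun_eq_iff[symmetric])
    then show ?case using lip bdd mono by (intro exI[of _ 0] exI[of _ f]) auto
  next
    case (Suc k)
    then obtain C g where g: "0 \<le> C" "smooth_upto n k C g" "l1_lipschitz n L g" "\<And>x. \<bar>g x\<bar> \<le> B"
      "\<And>x y. (\<And>i. x i \<le> y i) \<Longrightarrow> g x \<le> g y" "\<And>x. \<bar>g x - f x\<bar> \<le> real k * L * \<epsilon>"
      by (auto simp: Suc_le_eq)
    have "avg \<epsilon> k g x \<le> avg \<epsilon> k g y" if "\<forall>i. x i \<le> y i" for x y
      by (rule avg_mono[OF g(3,3) \<open>0 < \<epsilon>\<close>], rule g(5)) (use that in auto)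
    moreover have "\<bar>avg \<epsilon> k g x - f x\<bar> \<le> real (Suc k) * L * \<epsilon>" for x
      using avg_approx[OF g(3) \<open>0 < \<epsilon>\<close> \<open>0 \<le> L\<close>, of k x] g(6)[of x] by (simp add: algebra_simps abs_le_iff)
    moreover have "smooth_upto n (Suc k) (C + 6 * L / \<epsilon> + L) (avg \<epsilon> k g)"
      using Suc.prems g \<open>0 \<le> L\<close> \<open>0 < \<epsilon>\<close> by (intro smooth_upto_avg) auto
    moreover have "0 \<le> C + 6 * L / \<epsilon> + L" using g(1) \<open>0 \<le> L\<close> \<open>0 < \<epsilon>\<close> by simp
    ultimately show ?case
      using avg_lipschitz[OF g(3) \<open>0 < \<epsilon>\<close>] avg_bounded[OF g(3) \<open>0 < \<epsilon>\<close> g(4)]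
      by (intro exI[of _ "C + 6 * L / \<epsilon> + L"] exI[of _ "avg \<epsilon> k g"]) auto
  qed
  from this[of n] obtain C g where g: "0 \<le> C" "smooth_upto n n C g" "l1_lipschitz n L g" "\<And>x. \<bar>g x\<bar> \<le> B"
    "\<And>x. \<bar>g x - f x\<bar> \<le> real n * L * \<epsilon>" by auto
  from g(2) obtain d where d: "\<And>i. i < n \<Longrightarrow> l1_lipschitz n C (d i)" "\<And>i x. i < n \<Longrightarrow> 0 \<le> d i x \<and> d i x \<le> C"
    "\<And>x y. (\<forall>i\<ge>n. y i = x i) \<Longrightarrow> \<bar>g y - g x - (\<Sum>i<n. d i x * (y i - x i))\<bar> \<le> C * (\<Sum>i<n. \<bar>y i - x i\<bar>)\<^sup>2"
    unfolding smooth_upto_def by blast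
  define C' where "C' = C + L + B"
  have "0 \<le> B" using bdd[of undefined] by simp
  then have C': "C \<le> C'" "L \<le> C'" "B \<le> C'" "0 \<le> C'" using g(1) \<open>0 \<le> L\<close> by (simp_all add: C'_def)
  \<comment> \<open>\<open>smooth_increasing\<close> wants bounds for every index, while
    \<open>d\<close> is controlled only below \<open>n\<close>.\<close>
  define e where "e i = (if i < n then d i else (\<lambda>_. 0))" for i
  have "e i \<in> borel_measurable borel" for i
    using l1_lipschitz_continuous[OF d(1)] by (auto simp: e_def intro!: borel_measurable_continuous_onI)
  moreover have "0 \<le> e i x \<and> e i x \<le> C'" for i x
    using d(2)[of i x] C' by (auto simp: e_def)
  moreover have "\<bar>g y - g x - (\<Sum>i<n. e i x * (y i - x i))\<bar> \<le> C' * (\<Sum>i<n. \<bar>y i - x i\<bar>)\<^sup>2" for x y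
  proof -
    \<comment> \<open>Agrees with \<open>x\<close> from \<open>n\<close> on, so that the Taylor
      bound for \<open>d\<close> applies, and with \<open>y\<close> below \<open>n\<close>, so that
      \<open>g\<close> cannot distinguish it from \<open>y\<close>.\<close>
    define z where "z i = (if i < n then y i else x i)" for i
    have "\<bar>g z - g y\<bar> \<le> L * (\<Sum>i<n. \<bar>z i - y i\<bar>)" by (rule l1_lipschitzD[OF g(3)])
    then have "g z = g y" by (simp add: z_def)
    moreover have "(\<Sum>i<n. d i x * (z i - x i)) = (\<Sum>i<n. e i x * (y i - x i))"
      "(\<Sum>i<n. \<bar>z i - x i\<bar>) = (\<Sum>i<n. \<bar>y i - x i\<bar>)"
      by (intro sum.cong; simp add: z_def e_def)+
    ultimately have "\<bar>g y - g x - (\<Sum>i<n. e i x * (y i - x i))\<bar> \<le> C * (\<Sum>i<n. \<bar>y i - x i\<bar>)\<^sup>2"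
      using d(3)[of z x] by (simp add: z_def)
    also have "\<dots> \<le> C' * (\<Sum>i<n. \<bar>y i - x i\<bar>)\<^sup>2" using C' by (intro mult_right_mono) auto
    finally show ?thesis .
  qed
  moreover have "\<bar>g x\<bar> \<le> C'" for x using g(4)[of x] C' by simp
  ultimately have "smooth_increasing n C' g"
    unfolding smooth_increasing_def using l1_lipschitz_mono[OF g(3) C'(2)] by blast
  then show thesis using g(4,5) that by blast
qed

text \<open>Dominated convergence under a uniform bound. It serves all three approximations:
  smoothing, Bernstein polynomials and inf-convolution.\<close>

lemma (in prob_space) covariance_nonneg_limit:
  fixes F G :: "nat \<Rightarrow> 'a \<Rightarrow> real"
  assumes "\<And>n. F n \<in> borel_measurable M" "\<And>n. G n \<in> borel_measurable M"
    and "f \<in> borel_measurable M" "g \<in> borel_measurable M"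
    and F: "AE \<omega> in M. (\<lambda>n. F n \<omega>) \<longlonglongrightarrow> f \<omega>" and G: "AE \<omega> in M. (\<lambda>n. G n \<omega>) \<longlonglongrightarrow> g \<omega>"
    and bdd: "\<And>n \<omega>. \<omega> \<in> space M \<Longrightarrow> \<bar>F n \<omega>\<bar> \<le> B" "\<And>n \<omega>. \<omega> \<in> space M \<Longrightarrow> \<bar>G n \<omega>\<bar> \<le> B"
    and ineq: "\<And>n. (\<integral>\<omega>. F n \<omega> \<partial>M) * (\<integral>\<omega>. G n \<omega> \<partial>M) \<le> (\<integral>\<omega>. F n \<omega> * G n \<omega> \<partial>M)"
  shows "(\<integral>\<omega>. f \<omega> \<partial>M) * (\<integral>\<omega>. g \<omega> \<partial>M) \<le> (\<integral>\<omega>. f \<omega> * g \<omega> \<partial>M)"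
proof -
  note [measurable] = assms(1-4)
  have "(\<lambda>n. \<integral>\<omega>. F n \<omega> \<partial>M) \<longlonglongrightarrow> (\<integral>\<omega>. f \<omega> \<partial>M)"
    by (rule integral_dominated_convergence[where w = "\<lambda>_. B"]) (use F bdd in auto)
  moreover have "(\<lambda>n. \<integral>\<omega>. G n \<omega> \<partial>M) \<longlonglongrightarrow> (\<integral>\<omega>. g \<omega> \<partial>M)"
    by (rule integral_dominated_convergence[where w = "\<lambda>_. B"]) (use G bdd in auto)
  moreover have "(\<lambda>n. \<integral>\<omega>. F n \<omega> * G n \<omega> \<partial>M) \<longlonglongrightarrow> (\<integral>\<omega>. f \<omega> * g \<omega> \<partial>M)"
  proof (rule integral_dominated_convergence[where w = "\<lambda>_. B * B"])
    show "AE \<omega> in M. norm (F n \<omega> * G n \<omega>) \<le> B * B" for n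
      unfolding real_norm_def abs_mult
      by (intro AE_I2 mult_mono bdd abs_ge_zero order_trans[OF abs_ge_zero bdd(1)])
    show "AE \<omega> in M. (\<lambda>n. F n \<omega> * G n \<omega>) \<longlonglongrightarrow> f \<omega> * g \<omega>"
      using F G by eventually_elim (rule tendsto_mult)
  qed auto
  ultimately show ?thesis
    using ineq by (intro LIMSEQ_le[OF tendsto_mult]) auto
qed

lemma (in centered_gaussian_sequence) association_lipschitz:
  assumes cov: "\<And>i j. 0 \<le> (\<integral>\<omega>. Y i \<omega> * Y j \<omega> \<partial>M)"
    and "0 \<le> L" and f: "l1_lipschitz n L f" "\<And>x. \<bar>f x\<bar> \<le> B" "\<And>x y. (\<And>i. x i \<le> y i) \<Longrightarrow> f x \<le> f y"
    and g: "l1_lipschitz n L g" "\<And>x. \<bar>g x\<bar> \<le> B" "\<And>x y. (\<And>i. x i \<le> y i) \<Longrightarrow> g x \<le> g y"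
  shows "(\<integral>\<omega>. f (\<lambda>i. Y i \<omega>) \<partial>M) * (\<integral>\<omega>. g (\<lambda>i. Y i \<omega>) \<partial>M)
    \<le> (\<integral>\<omega>. f (\<lambda>i. Y i \<omega>) * g (\<lambda>i. Y i \<omega>) \<partial>M)"
proof -
  define \<epsilon> where "\<epsilon> m = 1 / real (Suc m)" for m
  have \<epsilon>: "0 < \<epsilon> m" for m by (simp add: \<epsilon>_def)
  have ex: "\<exists>C k. smooth_increasing n C k \<and> (\<forall>x. \<bar>k x - h x\<bar> \<le> real n * L * \<epsilon> m) \<and> (\<forall>x. \<bar>k x\<bar> \<le> B)"
    if "l1_lipschitz n L h" "\<And>x. \<bar>h x\<bar> \<le> B" "\<And>x y. (\<And>i. x i \<le> y i) \<Longrightarrow> h x \<le> h y" for h m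
    by (rule smooth_approximation[OF that \<open>0 \<le> L\<close> \<epsilon>[of m]]) blast+
  have "\<forall>m. \<exists>C k. smooth_increasing n C k \<and> (\<forall>x. \<bar>k x - f x\<bar> \<le> real n * L * \<epsilon> m) \<and> (\<forall>x. \<bar>k x\<bar> \<le> B)"
    by (intro allI ex[OF f])
  then obtain C f' where "\<forall>m. smooth_increasing n (C m) (f' m) \<and> (\<forall>x. \<bar>f' m x - f x\<bar> \<le> real n * L * \<epsilon> m) \<and> (\<forall>x. \<bar>f' m x\<bar> \<le> B)"
    by (simp only: choice_iff) blast
  then have f': "\<And>m. smooth_increasing n (C m) (f' m)" "\<And>m x. \<bar>f' m x - f x\<bar> \<le> real n * L * \<epsilon> m"
    "\<And>m x. \<bar>f' m x\<bar> \<le> B" by auto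
  have "\<forall>m. \<exists>C k. smooth_increasing n C k \<and> (\<forall>x. \<bar>k x - g x\<bar> \<le> real n * L * \<epsilon> m) \<and> (\<forall>x. \<bar>k x\<bar> \<le> B)"
    by (intro allI ex[OF g])
  then obtain D g' where "\<forall>m. smooth_increasing n (D m) (g' m) \<and> (\<forall>x. \<bar>g' m x - g x\<bar> \<le> real n * L * \<epsilon> m) \<and> (\<forall>x. \<bar>g' m x\<bar> \<le> B)"
    by (simp only: choice_iff) blast
  then have g': "\<And>m. smooth_increasing n (D m) (g' m)" "\<And>m x. \<bar>g' m x - g x\<bar> \<le> real n * L * \<epsilon> m"
    "\<And>m x. \<bar>g' m x\<bar> \<le> B" by auto
  have "(\<lambda>m. real n * L * \<epsilon> m) \<longlonglongrightarrow> real n * L * 0"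
    unfolding \<epsilon>_def using LIMSEQ_inverse_real_of_nat by (intro tendsto_intros) (simp add: inverse_eq_divide)
  then have \<epsilon>0: "(\<lambda>m. real n * L * \<epsilon> m) \<longlonglongrightarrow> 0" by simp
  have lim: "(\<lambda>m. f' m x) \<longlonglongrightarrow> f x" "(\<lambda>m. g' m x) \<longlonglongrightarrow> g x" for x
    by (rule LIM_zero_cancel, rule Lim_null_comparison[OF _ \<epsilon>0]; simp add: f'(2) g'(2))+
  have lip: "l1_lipschitz n (C m) (f' m)" "l1_lipschitz n (D m) (g' m)" for m
    using f'(1)[of m] g'(1)[of m] by (simp_all add: smooth_increasing_def)
  note meas = continuous_imp_borel_measurable_seq[OF l1_lipschitz_continuous measurable_coord]
  have ineq: "(\<integral>\<omega>. f' m (\<lambda>i. Y i \<omega>) \<partial>M) * (\<integral>\<omega>. g' m (\<lambda>i. Y i \<omega>) \<partial>M)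
      \<le> (\<integral>\<omega>. f' m (\<lambda>i. Y i \<omega>) * g' m (\<lambda>i. Y i \<omega>) \<partial>M)" for m
  proof -
    \<comment> \<open>Smoothing yields separate constants for the two functions, and the semigroup
      inequality asks for a common one. At the starting point 0, \<open>heat 1\<close> is the
      expectation of the function of \<open>Y\<close>.\<close>
    have "smooth_increasing n (max (C m) (D m)) (f' m)" "smooth_increasing n (max (C m) (D m)) (g' m)"
      by (rule smooth_increasing_mono[OF f'(1)] smooth_increasing_mono[OF g'(1)]; simp)+
    from heat_mult_smooth_increasing[OF cov this, of "\<lambda>_. 0"] show ?thesis by (simp add: heat_def)
  qed
  show ?thesis
    by (rule covariance_nonneg_limit[OF meas[OF lip(1)] meas[OF lip(2)] meas[OF f(1)] meas[OF g(1)]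
          AE_I2[OF lim(1)] AE_I2[OF lim(2)] f'(3) g'(3) ineq])
qed

section \<open>The path space\<close>

lemma path_bdd_above:
  assumes "\<alpha> \<in> mspace (path_space T)" "\<beta> \<in> mspace (path_space T)"
  shows "bdd_above ((\<lambda>t. \<bar>\<alpha> t - \<beta> t\<bar>) ` {0..T})"
proof -
  have "continuous_on {0..T} (\<lambda>t. \<bar>\<alpha> t - \<beta> t\<bar>)"
    using assms by (auto simp: mspace_path_space intro!: continuous_intros)
  then have "compact ((\<lambda>t. \<bar>\<alpha> t - \<beta> t\<bar>) ` {0..T})"
    by (rule compact_continuous_image) simp
  then show ?thesis by (intro bounded_imp_bdd_above compact_imp_bounded)
qed

lemma abs_diff_le_mdist:
  assumes "0 \<le> T" "\<alpha> \<in> mspace (path_space T)" "\<beta> \<in> mspace (path_space T)" "t \<in> {0..T}"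
  shows "\<bar>\<alpha> t - \<beta> t\<bar> \<le> mdist (path_space T) \<alpha> \<beta>"
  unfolding mdist_path_space[OF assms(1-3)]
  by (rule cSUP_upper[OF assms(4) path_bdd_above[OF assms(2,3)]])

lemma mdist_path_le:
  assumes "0 \<le> T" "\<alpha> \<in> mspace (path_space T)" "\<beta> \<in> mspace (path_space T)"
    and "\<And>t. t \<in> {0..T} \<Longrightarrow> \<bar>\<alpha> t - \<beta> t\<bar> \<le> D"
  shows "mdist (path_space T) \<alpha> \<beta> \<le> D"
  unfolding mdist_path_space[OF assms(1-3)] using assms by (intro cSUP_least) auto

lemma Metric_space_path: "Metric_space (mspace (path_space T)) (mdist (path_space T))"
  by (rule Metric_space_mspace_mdist)

lemma openin_path_space:
  "openin (mtopology_of (path_space T)) U \<longleftrightarrow> U \<subseteq> mspace (path_space T) \<and>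
     (\<forall>\<alpha>\<in>U. \<exists>r>0. \<forall>\<beta>\<in>mspace (path_space T). mdist (path_space T) \<alpha> \<beta> < r \<longrightarrow> \<beta> \<in> U)"
proof -
  interpret Metric_space "mspace (path_space T)" "mdist (path_space T)" by (rule Metric_space_path)
  show ?thesis
    unfolding mtopology_of_def openin_mtopology Ball_def[of U]
  proof (intro conj_cong[OF refl] iff_allI imp_cong[OF refl] iff_exI)
    fix \<alpha> r
    assume "U \<subseteq> mspace (path_space T)" "\<alpha> \<in> U"
    then show "mball \<alpha> r \<subseteq> U \<longleftrightarrow> (\<forall>\<beta>\<in>mspace (path_space T). mdist (path_space T) \<alpha> \<beta> < r \<longrightarrow> \<beta> \<in> U)"
      by (auto simp: subset_iff)
  qed
qed

lemma topcontinuous_at_path_space: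
  fixes F :: "(real \<Rightarrow> real) \<Rightarrow> real"
  shows "topcontinuous_at (mtopology_of (path_space T)) euclidean F \<alpha> \<longleftrightarrow>
    \<alpha> \<in> mspace (path_space T) \<and> (\<forall>\<epsilon>>0. \<exists>\<delta>>0. \<forall>\<beta>\<in>mspace (path_space T).
       mdist (path_space T) \<alpha> \<beta> < \<delta> \<longrightarrow> \<bar>F \<beta> - F \<alpha>\<bar> < \<epsilon>)"
proof -
  interpret Metric_space "mspace (path_space T)" "mdist (path_space T)" by (rule Metric_space_path)
  show ?thesis
  proof (intro iffI conjI allI impI)
    assume c: "topcontinuous_at (mtopology_of (path_space T)) euclidean F \<alpha>"
    then show \<alpha>: "\<alpha> \<in> mspace (path_space T)" by (simp add: topcontinuous_at_def)
    fix \<epsilon> :: real assume "0 < \<epsilon>"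
    then obtain U where U: "openin (mtopology_of (path_space T)) U" "\<alpha> \<in> U" "\<forall>y\<in>U. F y \<in> ball (F \<alpha>) \<epsilon>"
      using c unfolding topcontinuous_at_def by (metis centre_in_ball open_ball open_openin)
    from U(1,2) obtain r where "0 < r" "\<forall>\<beta>\<in>mspace (path_space T). mdist (path_space T) \<alpha> \<beta> < r \<longrightarrow> \<beta> \<in> U"
      unfolding openin_path_space by blast
    with U(3) show "\<exists>\<delta>>0. \<forall>\<beta>\<in>mspace (path_space T). mdist (path_space T) \<alpha> \<beta> < \<delta> \<longrightarrow> \<bar>F \<beta> - F \<alpha>\<bar> < \<epsilon>"
      by (intro exI[of _ r]) (auto simp: dist_real_def abs_minus_commute)
  next
    assume c: "\<alpha> \<in> mspace (path_space T) \<and> (\<forall>\<epsilon>>0. \<exists>\<delta>>0. \<forall>\<beta>\<in>mspace (path_space T).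
       mdist (path_space T) \<alpha> \<beta> < \<delta> \<longrightarrow> \<bar>F \<beta> - F \<alpha>\<bar> < \<epsilon>)"
    show "topcontinuous_at (mtopology_of (path_space T)) euclidean F \<alpha>"
      unfolding topcontinuous_at_def
    proof (intro conjI allI impI)
      fix V :: "real set" assume "openin euclidean V \<and> F \<alpha> \<in> V"
      then obtain \<epsilon> where "0 < \<epsilon>" "ball (F \<alpha>) \<epsilon> \<subseteq> V"
        using open_contains_ball by (metis open_openin)
      moreover obtain \<delta> where "0 < \<delta>" "\<forall>\<beta>\<in>mspace (path_space T). mdist (path_space T) \<alpha> \<beta> < \<delta> \<longrightarrow> \<bar>F \<beta> - F \<alpha>\<bar> < \<epsilon>"
        using c \<open>0 < \<epsilon>\<close> by blast
      ultimately have "\<forall>\<beta>\<in>mball \<alpha> \<delta>. F \<beta> \<in> V"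
        by (auto simp: subset_iff dist_real_def abs_minus_commute)
      moreover have "openin (mtopology_of (path_space T)) (mball \<alpha> \<delta>)" "\<alpha> \<in> mball \<alpha> \<delta>"
        using c \<open>0 < \<delta>\<close> by (auto simp: mtopology_of_def)
      ultimately show "\<exists>U. openin (mtopology_of (path_space T)) U \<and> \<alpha> \<in> U \<and> (\<forall>y\<in>U. F y \<in> V)" by blast
    qed (use c in auto)
  qed
qed

lemma space_path_borel: "space (path_borel T) = mspace (path_space T)"
  and sets_path_borel: "sets (path_borel T) =
    sigma_sets (mspace (path_space T)) {U. openin (mtopology_of (path_space T)) U}"
proof -
  have "{U. openin (mtopology_of (path_space T)) U} \<subseteq> Pow (mspace (path_space T))"
    by (auto simp: openin_path_space)
  then show "space (path_borel T) = mspace (path_space T)"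
    "sets (path_borel T) = sigma_sets (mspace (path_space T)) {U. openin (mtopology_of (path_space T)) U}"
    by (simp_all add: path_borel_def space_measure_of_conv sets_measure_of)
qed

section \<open>Lipschitz functionals: continuity and Borel measurability\<close>

definition path_lipschitz :: "real \<Rightarrow> real \<Rightarrow> ((real \<Rightarrow> real) \<Rightarrow> real) \<Rightarrow> bool" where
  "path_lipschitz T L F \<longleftrightarrow> (\<forall>\<alpha>\<in>mspace (path_space T). \<forall>\<beta>\<in>mspace (path_space T).
     \<bar>F \<alpha> - F \<beta>\<bar> \<le> L * mdist (path_space T) \<alpha> \<beta>)"

lemma path_lipschitz_topcontinuous_at:
  assumes "path_lipschitz T L F" "\<alpha> \<in> mspace (path_space T)"
  shows "topcontinuous_at (mtopology_of (path_space T)) euclidean F \<alpha>"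
  unfolding topcontinuous_at_path_space
proof (intro conjI allI impI)
  fix \<epsilon> :: real assume "0 < \<epsilon>"
  have "\<bar>F \<beta> - F \<alpha>\<bar> < \<epsilon>" if "\<beta> \<in> mspace (path_space T)" "mdist (path_space T) \<alpha> \<beta> < \<epsilon> / (\<bar>L\<bar> + 1)" for \<beta>
  proof -
    have d0: "0 \<le> mdist (path_space T) \<alpha> \<beta>" using Metric_space.nonneg[OF Metric_space_path] .
    have "\<bar>F \<beta> - F \<alpha>\<bar> \<le> L * mdist (path_space T) \<alpha> \<beta>"
      using assms that by (auto simp: path_lipschitz_def abs_minus_commute)
    also have "\<dots> \<le> (\<bar>L\<bar> + 1) * mdist (path_space T) \<alpha> \<beta>" using d0 by (intro mult_right_mono) auto
    also have "\<dots> < \<epsilon>" using that(2) by (simp add: field_simps)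
    finally show ?thesis .
  qed
  then show "\<exists>\<delta>>0. \<forall>\<beta>\<in>mspace (path_space T). mdist (path_space T) \<alpha> \<beta> < \<delta> \<longrightarrow> \<bar>F \<beta> - F \<alpha>\<bar> < \<epsilon>"
    using \<open>0 < \<epsilon>\<close> by (intro exI[of _ "\<epsilon> / (\<bar>L\<bar> + 1)"]) auto
qed (rule assms)

lemma path_lipschitz_borel_measurable:
  assumes "path_lipschitz T L F"
  shows "F \<in> borel_measurable (path_borel T)"
proof (rule borel_measurableI)
  fix V :: "real set" assume "open V"
  have "openin (mtopology_of (path_space T)) (F -` V \<inter> mspace (path_space T))"
    unfolding openin_path_space
  proof (intro conjI ballI)
    fix \<alpha> assume \<alpha>: "\<alpha> \<in> F -` V \<inter> mspace (path_space T)"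
    then obtain \<epsilon> where \<epsilon>: "0 < \<epsilon>" "ball (F \<alpha>) \<epsilon> \<subseteq> V" using \<open>open V\<close> open_contains_ball by blast
    from path_lipschitz_topcontinuous_at[OF assms, of \<alpha>] \<alpha> \<epsilon>(1)
    obtain \<delta> where \<delta>: "0 < \<delta>" "\<forall>\<beta>\<in>mspace (path_space T). mdist (path_space T) \<alpha> \<beta> < \<delta> \<longrightarrow> \<bar>F \<beta> - F \<alpha>\<bar> < \<epsilon>"
      unfolding topcontinuous_at_path_space by blast
    then show "\<exists>r>0. \<forall>\<beta>\<in>mspace (path_space T). mdist (path_space T) \<alpha> \<beta> < r \<longrightarrow> \<beta> \<in> F -` V \<inter> mspace (path_space T)"
      using \<epsilon>(2) by (intro exI[of _ \<delta>]) (auto simp: subset_iff dist_real_def abs_minus_commute)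
  qed simp
  then show "F -` V \<inter> space (path_borel T) \<in> sets (path_borel T)"
    by (auto simp: space_path_borel sets_path_borel)
qed

section \<open>Bernstein polynomials with coefficient sequence \<open>x\<close> on
  \<open>{0..T}\<close>\<close>

definition bernstein_path :: "real \<Rightarrow> nat \<Rightarrow> (nat \<Rightarrow> real) \<Rightarrow> real \<Rightarrow> real" where
  "bernstein_path T n x = restrict (\<lambda>t. \<Sum>k\<le>n. x k * Bernstein n k (t / T)) {0..T}"

text \<open>The minimum keeps the nodes with \<open>k > n\<close>, which carry no weight, in \<open>{0..T}\<close>; for \<open>n = 0\<close> the quotient is 0.\<close>

definition node :: "real \<Rightarrow> nat \<Rightarrow> nat \<Rightarrow> real" where
  "node T n k = T * (real (min k n) / real n)"

lemma node_in: "0 \<le> T \<Longrightarrow> node T n k \<in> {0..T}"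
  by (auto simp: node_def divide_simps intro!: mult_nonneg_nonneg mult_left_mono)

lemma Bernstein_nonneg_scaled: "0 < T \<Longrightarrow> t \<in> {0..T} \<Longrightarrow> 0 \<le> Bernstein n k (t / T)"
  by (intro Bernstein_nonneg) auto

lemma bernstein_path_in_mspace: "bernstein_path T n x \<in> mspace (path_space T)"
proof -
  have "continuous_on {0..T} (\<lambda>t. \<Sum>k\<le>n. x k * Bernstein n k (t / T))"
    unfolding Bernstein_def divide_inverse by (intro continuous_intros)
  then have "continuous_on {0..T} (bernstein_path T n x)"
    by (rule continuous_on_eq) (simp add: bernstein_path_def)
  then show ?thesis by (simp add: mspace_path_space bernstein_path_def)
qed

text \<open>The reason for choosing Bernstein polynomials: their weights are nonnegative, so the
  approximation respects the order.\<close>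

lemma bernstein_path_mono:
  assumes "0 < T" "\<And>k. x k \<le> y k"
  shows "path_le T (bernstein_path T n x) (bernstein_path T n y)"
  unfolding path_le_def bernstein_path_def
  using assms Bernstein_nonneg_scaled[OF assms(1)] by (auto intro!: sum_mono mult_right_mono)

text \<open>The weights are nonnegative with sum 1, so each is at most 1. Degree \<open>n\<close>
  uses \<open>Suc n\<close> coefficients, and the sum of their differences, cruder than the maximum,
  is the quantity in \<open>l1_lipschitz\<close>.\<close>

lemma bernstein_path_lipschitz:
  assumes "0 < T"
  shows "mdist (path_space T) (bernstein_path T n x) (bernstein_path T n y) \<le> (\<Sum>k<Suc n. \<bar>x k - y k\<bar>)"
proof (rule mdist_path_le)
  fix t assume t: "t \<in> {0..T}"
  note B0 = Bernstein_nonneg_scaled[OF assms t]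
  have B1: "Bernstein n k (t / T) \<le> 1" if "k \<le> n" for k
    using member_le_sum[of k "{..n}" "\<lambda>k. Bernstein n k (t / T)"] B0 that by simp
  have "bernstein_path T n x t - bernstein_path T n y t = (\<Sum>k\<le>n. (x k - y k) * Bernstein n k (t / T))"
    using t by (simp add: bernstein_path_def sum_subtractf left_diff_distrib)
  also have "\<bar>\<dots>\<bar> \<le> (\<Sum>k\<le>n. \<bar>x k - y k\<bar>)"
    using B0 B1 by (intro sum_abs[THEN order_trans] sum_mono) (simp add: abs_mult mult_left_le)
  finally show "\<bar>bernstein_path T n x t - bernstein_path T n y t\<bar> \<le> (\<Sum>k<Suc n. \<bar>x k - y k\<bar>)"
    by (simp only: lessThan_Suc_atMost)
qed (use assms bernstein_path_in_mspace in auto)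

lemma bernstein_path_tendsto:
  assumes "0 < T" "\<alpha> \<in> mspace (path_space T)"
  shows "(\<lambda>n. mdist (path_space T) (bernstein_path T n (\<lambda>k. \<alpha> (node T n k))) \<alpha>) \<longlonglongrightarrow> 0"
proof (rule LIMSEQ_I)
  fix e :: real assume "0 < e"
  have "continuous_on {0..1} (\<lambda>s. \<alpha> (T * s))"
  proof (rule continuous_on_compose2[of "{0..T}" \<alpha>])
    show "(\<lambda>s. T * s) ` {0..1} \<subseteq> {0..T}" using assms(1) by (auto intro: mult_left_le)
  qed (use assms(2) in \<open>auto simp: mspace_path_space intro!: continuous_intros\<close>)
  from Bernstein_Weierstrass[OF this, of "e / 2"] \<open>0 < e\<close>
  obtain N where N: "\<And>n x. N \<le> n \<Longrightarrow> x \<in> {0..1} \<Longrightarrow>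
      \<bar>\<alpha> (T * x) - (\<Sum>k\<le>n. \<alpha> (T * (real k / real n)) * Bernstein n k x)\<bar> < e / 2"
    by auto
  have "mdist (path_space T) (bernstein_path T n (\<lambda>k. \<alpha> (node T n k))) \<alpha> \<le> e / 2" if "N \<le> n" for n
  proof (rule mdist_path_le)
    fix t assume t: "t \<in> {0..T}"
    have "(\<Sum>k\<le>n. \<alpha> (node T n k) * Bernstein n k (t / T)) =
        (\<Sum>k\<le>n. \<alpha> (T * (real k / real n)) * Bernstein n k (t / T))"
      by (intro sum.cong) (auto simp: node_def)
    then show "\<bar>bernstein_path T n (\<lambda>k. \<alpha> (node T n k)) t - \<alpha> t\<bar> \<le> e / 2"
      using N[OF that, of "t / T"] t assms(1) by (simp add: bernstein_path_def abs_minus_commute)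
  qed (use assms bernstein_path_in_mspace in auto)
  then have "norm (mdist (path_space T) (bernstein_path T n (\<lambda>k. \<alpha> (node T n k))) \<alpha> - 0) < e" if "N \<le> n" for n
    using that \<open>0 < e\<close> Metric_space.nonneg[OF Metric_space_path] by (fastforce intro: le_less_trans)
  then show "\<exists>N. \<forall>n\<ge>N. norm (mdist (path_space T) (bernstein_path T n (\<lambda>k. \<alpha> (node T n k))) \<alpha> - 0) < e"
    by blast
qed

lemma l1_lipschitz_bernstein:
  assumes "0 < T" "path_lipschitz T L F" "0 \<le> L"
  shows "l1_lipschitz (Suc n) L (\<lambda>x. F (bernstein_path T n x))"
  unfolding l1_lipschitz_def
proof (intro allI)
  fix x y
  have "\<bar>F (bernstein_path T n y) - F (bernstein_path T n x)\<bar> \<le>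
      L * mdist (path_space T) (bernstein_path T n y) (bernstein_path T n x)"
    using assms(2) bernstein_path_in_mspace by (simp add: path_lipschitz_def)
  also have "\<dots> \<le> L * (\<Sum>k<Suc n. \<bar>y k - x k\<bar>)"
    by (rule mult_left_mono[OF bernstein_path_lipschitz[OF assms(1)] assms(3)])
  finally show "\<bar>F (bernstein_path T n y) - F (bernstein_path T n x)\<bar> \<le> L * (\<Sum>k<Suc n. \<bar>y k - x k\<bar>)" .
qed

lemma path_lipschitz_bernstein_tendsto:
  assumes "0 < T" "path_lipschitz T L F" "\<alpha> \<in> mspace (path_space T)"
  shows "(\<lambda>n. F (bernstein_path T n (\<lambda>k. \<alpha> (node T n k)))) \<longlonglongrightarrow> F \<alpha>"
proof (rule LIM_zero_cancel, rule Lim_null_comparison)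
  show "\<forall>\<^sub>F n in sequentially. norm (F (bernstein_path T n (\<lambda>k. \<alpha> (node T n k))) - F \<alpha>)
      \<le> L * mdist (path_space T) (bernstein_path T n (\<lambda>k. \<alpha> (node T n k))) \<alpha>"
    using assms(2,3) bernstein_path_in_mspace by (simp add: path_lipschitz_def)
  show "(\<lambda>n. L * mdist (path_space T) (bernstein_path T n (\<lambda>k. \<alpha> (node T n k))) \<alpha>) \<longlonglongrightarrow> 0"
    by (rule tendsto_mult_right_zero[OF bernstein_path_tendsto[OF assms(1,3)]])
qed

section \<open>Measurability of the sample path\<close>

lemma sample_path_in_mspace:
  assumes "continuous_on {0..T} (\<lambda>t. X t \<omega>)"
  shows "sample_path T X \<omega> \<in> mspace (path_space T)"
proof -
  have "continuous_on {0..T} (sample_path T X \<omega>)"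
    by (rule continuous_on_eq[OF assms]) (simp add: sample_path_def)
  then show ?thesis by (simp add: mspace_path_space sample_path_def)
qed

lemma sample_path_bernstein_tendsto:
  assumes "0 < T" "path_lipschitz T L F" "continuous_on {0..T} (\<lambda>t. X t \<omega>)"
  shows "(\<lambda>n. F (bernstein_path T n (\<lambda>k. X (node T n k) \<omega>))) \<longlonglongrightarrow> F (sample_path T X \<omega>)"
  using path_lipschitz_bernstein_tendsto[OF assms(1,2) sample_path_in_mspace[where X = X and \<omega> = \<omega>, OF assms(3)]]
    node_in[of T] assms(1) by (simp add: sample_path_def)

text \<open>Pointwise limit of continuous functions of finitely many \<open>X t\<close>; this is how
  measurability of the coordinates reaches functionals of the whole path.\<close>

lemma path_lipschitz_sample_measurable:
  assumes "0 < T" "0 \<le> L" "path_lipschitz T L F" "\<And>t. t \<in> {0..T} \<Longrightarrow> X t \<in> borel_measurable M"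
    and "\<And>\<omega>. \<omega> \<in> space M \<Longrightarrow> continuous_on {0..T} (\<lambda>t. X t \<omega>)"
  shows "(\<lambda>\<omega>. F (sample_path T X \<omega>)) \<in> borel_measurable M"
proof (rule borel_measurable_LIMSEQ_real)
  show "(\<lambda>n. F (bernstein_path T n (\<lambda>k. X (node T n k) \<omega>))) \<longlonglongrightarrow> F (sample_path T X \<omega>)" if "\<omega> \<in> space M" for \<omega>
    by (rule sample_path_bernstein_tendsto[where X = X and \<omega> = \<omega>, OF assms(1,3) assms(5)[OF that]])
  show "(\<lambda>\<omega>. F (bernstein_path T n (\<lambda>k. X (node T n k) \<omega>))) \<in> borel_measurable M" for n
    using l1_lipschitz_continuous[OF l1_lipschitz_bernstein[OF assms(1,3,2)]] assms(4) node_in[of T] assms(1)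
    by (intro continuous_imp_borel_measurable_seq[of "\<lambda>x. F (bernstein_path T n x)" "\<lambda>k. X (node T n k)"]) auto
qed

lemma path_lipschitz_dist_to:
  assumes "C \<noteq> {}" "C \<subseteq> mspace (path_space T)"
  shows "path_lipschitz T 1 (\<lambda>\<alpha>. Inf (mdist (path_space T) \<alpha> ` C))"
proof -
  interpret Metric_space "mspace (path_space T)" "mdist (path_space T)" by (rule Metric_space_path)
  have le: "Inf (mdist (path_space T) \<alpha> ` C) - Inf (mdist (path_space T) \<beta> ` C) \<le> mdist (path_space T) \<alpha> \<beta>"
    if "\<alpha> \<in> mspace (path_space T)" "\<beta> \<in> mspace (path_space T)" for \<alpha> \<beta>
  proof -
    have "Inf (mdist (path_space T) \<alpha> ` C) - mdist (path_space T) \<alpha> \<beta> \<le> mdist (path_space T) \<beta> \<gamma>" if "\<gamma> \<in> C" for \<gamma>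
    proof -
      have "Inf (mdist (path_space T) \<alpha> ` C) \<le> mdist (path_space T) \<alpha> \<gamma>"
        using that by (intro cINF_lower) (auto intro!: bdd_belowI[of _ 0])
      also have "\<dots> \<le> mdist (path_space T) \<alpha> \<beta> + mdist (path_space T) \<beta> \<gamma>"
        using \<open>\<alpha> \<in> _\<close> \<open>\<beta> \<in> _\<close> \<open>\<gamma> \<in> C\<close> assms(2) by (intro triangle) auto
      finally show ?thesis by simp
    qed
    then have "Inf (mdist (path_space T) \<alpha> ` C) - mdist (path_space T) \<alpha> \<beta> \<le> Inf (mdist (path_space T) \<beta> ` C)"
      using assms(1) by (intro cINF_greatest) auto
    then show ?thesis by simp
  qed
  show ?thesis
    unfolding path_lipschitz_def
  proof (intro ballI)
    fix \<alpha> \<beta> assume *: "\<alpha> \<in> mspace (path_space T)" "\<beta> \<in> mspace (path_space T)"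
    show "\<bar>Inf (mdist (path_space T) \<alpha> ` C) - Inf (mdist (path_space T) \<beta> ` C)\<bar> \<le> 1 * mdist (path_space T) \<alpha> \<beta>"
      using le[OF *] le[OF *(2,1)] commute[of \<alpha> \<beta>] by (simp add: abs_le_iff)
  qed
qed

text \<open>The \<sigma>-field is generated by the open sets, so these are tested directly: an open
  set is where the distance to its complement is positive, and that distance is 1-Lipschitz. The
  result makes \<open>path_law\<close> a genuine image measure.\<close>

lemma sample_path_measurable:
  assumes "0 < T" "\<And>t. t \<in> {0..T} \<Longrightarrow> X t \<in> borel_measurable M"
    and cont: "\<And>\<omega>. \<omega> \<in> space M \<Longrightarrow> continuous_on {0..T} (\<lambda>t. X t \<omega>)"
  shows "sample_path T X \<in> measurable M (path_borel T)"
  unfolding path_borel_def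
proof (rule measurable_measure_of)
  interpret Metric_space "mspace (path_space T)" "mdist (path_space T)" by (rule Metric_space_path)
  show in_space: "sample_path T X \<in> space M \<rightarrow> mspace (path_space T)"
    using sample_path_in_mspace[where X = X] cont by blast
  show "{U. openin (mtopology_of (path_space T)) U} \<subseteq> Pow (mspace (path_space T))"
    by (auto simp: openin_path_space)
  fix U assume "U \<in> {U. openin (mtopology_of (path_space T)) U}"
  then have U: "openin (mtopology_of (path_space T)) U" by simp
  then have sub: "U \<subseteq> mspace (path_space T)" by (simp add: openin_path_space)
  define C where "C = mspace (path_space T) - U"
  show "sample_path T X -` U \<inter> space M \<in> sets M"
  \<comment> \<open>An infimum over the empty set has no meaning as a distance, so the whole space
    is treated apart.\<close>
  proof (cases "C = {}")
    case True
    then have "U = mspace (path_space T)" using sub by (auto simp: C_def)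
    then have "sample_path T X -` U \<inter> space M = space M" using in_space by auto
    then show ?thesis by simp
  next
    case False
    define D where "D \<alpha> = Inf (mdist (path_space T) \<alpha> ` C)" for \<alpha>
    have lip: "path_lipschitz T 1 D"
      unfolding D_def by (rule path_lipschitz_dist_to[OF False]) (auto simp: C_def)
    have pos: "0 < D \<alpha> \<longleftrightarrow> \<alpha> \<in> U" if "\<alpha> \<in> mspace (path_space T)" for \<alpha>
    proof
      assume "\<alpha> \<in> U"
      with U obtain r where r: "0 < r" "\<forall>\<beta>\<in>mspace (path_space T). mdist (path_space T) \<alpha> \<beta> < r \<longrightarrow> \<beta> \<in> U"
        unfolding openin_path_space by blast
      have "r \<le> D \<alpha>" unfolding D_def
        using False r(2) by (intro cINF_greatest) (auto simp: C_def not_less[symmetric])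
      then show "0 < D \<alpha>" using r(1) by simp
    next
      assume D: "0 < D \<alpha>"
      show "\<alpha> \<in> U"
      proof (rule ccontr)
        assume "\<alpha> \<notin> U"
        then have "\<alpha> \<in> C" using that by (simp add: C_def)
        then have "D \<alpha> \<le> mdist (path_space T) \<alpha> \<alpha>"
          unfolding D_def by (intro cINF_lower) (auto intro!: bdd_belowI[of _ 0])
        with D that show False by simp
      qed
    qed
    have "(\<lambda>\<omega>. D (sample_path T X \<omega>)) \<in> borel_measurable M"
      by (rule path_lipschitz_sample_measurable[OF assms(1) _ lip assms(2) cont]) auto
    then have "{\<omega> \<in> space M. 0 < D (sample_path T X \<omega>)} \<in> sets M" by measurable
    moreover have "{\<omega> \<in> space M. 0 < D (sample_path T X \<omega>)} = sample_path T X -` U \<inter> space M"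
      using pos in_space by auto
    ultimately show ?thesis by simp
  qed
qed

section \<open>Lipschitz regularization of monotone functionals\<close>

definition shift_path :: "real \<Rightarrow> (real \<Rightarrow> real) \<Rightarrow> real \<Rightarrow> real \<Rightarrow> real" where
  "shift_path T \<alpha> u = restrict (\<lambda>t. \<alpha> t + u) {0..T}"

text \<open>Only constant shifts compete, not all paths: a perturbation of sup-norm d lies between
  the shifts by -d and d, so for a monotone functional one real parameter is enough to obtain a
  Lipschitz bound.\<close>

definition inf_conv :: "real \<Rightarrow> real \<Rightarrow> ((real \<Rightarrow> real) \<Rightarrow> real) \<Rightarrow> (real \<Rightarrow> real) \<Rightarrow> real" where
  "inf_conv T k F \<alpha> = (INF u. F (shift_path T \<alpha> u) + k * \<bar>u\<bar>)"

lemma shift_path_in_mspace: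
  assumes "\<alpha> \<in> mspace (path_space T)"
  shows "shift_path T \<alpha> u \<in> mspace (path_space T)"
proof -
  have "continuous_on {0..T} (shift_path T \<alpha> u)"
    by (rule continuous_on_eq[of _ "\<lambda>t. \<alpha> t + u"])
       (use assms in \<open>auto simp: shift_path_def mspace_path_space intro!: continuous_intros\<close>)
  then show ?thesis by (simp add: mspace_path_space shift_path_def)
qed

lemma shift_path_0: "\<alpha> \<in> mspace (path_space T) \<Longrightarrow> shift_path T \<alpha> 0 = \<alpha>"
  by (simp add: shift_path_def mspace_path_space extensional_restrict)

context
  fixes T k B :: real and F :: "(real \<Rightarrow> real) \<Rightarrow> real"
  assumes T: "0 < T" and k: "0 \<le> k"
    and bdd: "\<And>\<alpha>. \<alpha> \<in> mspace (path_space T) \<Longrightarrow> \<bar>F \<alpha>\<bar> \<le> B"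
    and mono: "monotone_on (mspace (path_space T)) (path_le T) (\<le>) F"
begin

lemma inf_conv_lower:
  assumes "\<alpha> \<in> mspace (path_space T)"
  shows "inf_conv T k F \<alpha> \<le> F (shift_path T \<alpha> u) + k * \<bar>u\<bar>"
  unfolding inf_conv_def
proof (rule cINF_lower)
  show "bdd_below (range (\<lambda>u. F (shift_path T \<alpha> u) + k * \<bar>u\<bar>))"
  proof (rule bdd_belowI2)
    fix u
    have "0 \<le> k * \<bar>u\<bar>" using k by simp
    then show "- B \<le> F (shift_path T \<alpha> u) + k * \<bar>u\<bar>"
      using bdd[OF shift_path_in_mspace[OF assms, of u]] by (simp add: abs_le_iff)
  qed
qed simp

lemma inf_conv_greatest:
  assumes "\<And>u. c \<le> F (shift_path T \<alpha> u) + k * \<bar>u\<bar>"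
  shows "c \<le> inf_conv T k F \<alpha>"
  unfolding inf_conv_def using assms by (intro cINF_greatest) auto

lemma inf_conv_le:
  assumes "\<alpha> \<in> mspace (path_space T)"
  shows "inf_conv T k F \<alpha> \<le> F \<alpha>"
  using inf_conv_lower[OF assms, of 0] shift_path_0[OF assms] by simp

lemma inf_conv_bounded:
  assumes "\<alpha> \<in> mspace (path_space T)"
  shows "\<bar>inf_conv T k F \<alpha>\<bar> \<le> B"
proof -
  have "- B \<le> F (shift_path T \<alpha> u) + k * \<bar>u\<bar>" for u
  proof -
    have "0 \<le> k * \<bar>u\<bar>" using k by simp
    then show ?thesis using bdd[OF shift_path_in_mspace[OF assms, of u]] by (simp add: abs_le_iff)
  qed
  then have "- B \<le> inf_conv T k F \<alpha>" by (rule inf_conv_greatest)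
  with inf_conv_le[OF assms] bdd[OF assms] show ?thesis by (simp add: abs_le_iff)
qed

text \<open>\<open>\<alpha> \<le> \<beta> + d\<close> gives \<open>F (\<alpha> + u - d) \<le> F (\<beta> + u)\<close>, so that the infimum for \<open>\<alpha>\<close> exceeds the one for
  \<open>\<beta>\<close> by at most \<open>k * \<bar>d\<bar>\<close>.\<close>

lemma inf_conv_shifted_le:
  assumes "\<alpha> \<in> mspace (path_space T)" "\<beta> \<in> mspace (path_space T)" "\<And>t. t \<in> {0..T} \<Longrightarrow> \<alpha> t \<le> \<beta> t + d"
  shows "inf_conv T k F \<alpha> \<le> inf_conv T k F \<beta> + k * \<bar>d\<bar>"
proof -
  have "inf_conv T k F \<alpha> - k * \<bar>d\<bar> \<le> F (shift_path T \<beta> u) + k * \<bar>u\<bar>" for u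
  proof -
    have "path_le T (shift_path T \<alpha> (u - d)) (shift_path T \<beta> u)"
      using assms(3) by (force simp: path_le_def shift_path_def)
    then have "F (shift_path T \<alpha> (u - d)) \<le> F (shift_path T \<beta> u)"
      using mono assms(1,2) by (simp add: monotone_on_def shift_path_in_mspace)
    moreover have "k * \<bar>u - d\<bar> \<le> k * (\<bar>u\<bar> + \<bar>d\<bar>)" using k by (intro mult_left_mono) auto
    ultimately show ?thesis
      using inf_conv_lower[OF assms(1), of "u - d"] by (simp add: distrib_left)
  qed
  then have "inf_conv T k F \<alpha> - k * \<bar>d\<bar> \<le> inf_conv T k F \<beta>" by (rule inf_conv_greatest)
  then show ?thesis by simp
qed

lemma inf_conv_mono:
  assumes "\<alpha> \<in> mspace (path_space T)" "\<beta> \<in> mspace (path_space T)" "path_le T \<alpha> \<beta>"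
  shows "inf_conv T k F \<alpha> \<le> inf_conv T k F \<beta>"
  using inf_conv_shifted_le[OF assms(1,2), of 0] assms(3) by (simp add: path_le_def)

lemma inf_conv_lipschitz: "path_lipschitz T k (inf_conv T k F)"
  unfolding path_lipschitz_def
proof (intro ballI)
  fix \<alpha> \<beta> assume *: "\<alpha> \<in> mspace (path_space T)" "\<beta> \<in> mspace (path_space T)"
  let ?d = "mdist (path_space T) \<alpha> \<beta>"
  have d0: "0 \<le> ?d" using Metric_space.nonneg[OF Metric_space_path] .
  have "\<alpha> t \<le> \<beta> t + ?d" "\<beta> t \<le> \<alpha> t + ?d" if "t \<in> {0..T}" for t
    using abs_diff_le_mdist[OF _ * that] T by (simp_all add: abs_le_iff)
  from inf_conv_shifted_le[OF * this(1)] inf_conv_shifted_le[OF *(2,1) this(2)] d0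
  show "\<bar>inf_conv T k F \<alpha> - inf_conv T k F \<beta>\<bar> \<le> k * ?d" by (simp add: abs_le_iff)
qed

end

text \<open>Shifts smaller than the continuity radius \<delta> change \<open>F\<close> by less than
  e / 2. Larger ones pay a penalty of at least 2 * B once n \<ge> 2 * B / \<delta>, which offsets
  any drop of \<open>F\<close>.\<close>

lemma inf_conv_tendsto:
  assumes T: "0 < T" and bdd: "\<And>\<alpha>. \<alpha> \<in> mspace (path_space T) \<Longrightarrow> \<bar>F \<alpha>\<bar> \<le> B"
    and mono: "monotone_on (mspace (path_space T)) (path_le T) (\<le>) F"
    and cont: "topcontinuous_at (mtopology_of (path_space T)) euclidean F \<alpha>"
  shows "(\<lambda>n. inf_conv T (real n) F \<alpha>) \<longlonglongrightarrow> F \<alpha>"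
proof (rule LIMSEQ_I)
  fix e :: real assume "0 < e"
  have \<alpha>: "\<alpha> \<in> mspace (path_space T)" using cont by (simp add: topcontinuous_at_path_space)
  obtain \<delta> where \<delta>: "0 < \<delta>" "\<And>\<beta>. \<beta> \<in> mspace (path_space T) \<Longrightarrow> mdist (path_space T) \<alpha> \<beta> < \<delta> \<Longrightarrow> \<bar>F \<beta> - F \<alpha>\<bar> < e / 2"
    using cont \<open>0 < e\<close> unfolding topcontinuous_at_path_space by (metis half_gt_zero)
  obtain N where N: "2 * B / \<delta> \<le> real N" using real_arch_simple by blast
  have "norm (inf_conv T (real n) F \<alpha> - F \<alpha>) < e" if "N \<le> n" for n
  proof -
    have "F \<alpha> - e / 2 \<le> F (shift_path T \<alpha> u) + real n * \<bar>u\<bar>" for u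
    proof (cases "\<bar>u\<bar> < \<delta>")
      case True
      have "mdist (path_space T) \<alpha> (shift_path T \<alpha> u) \<le> \<bar>u\<bar>"
        by (rule mdist_path_le) (use T \<alpha> in \<open>auto simp: shift_path_in_mspace, simp add: shift_path_def\<close>)
      then have "\<bar>F (shift_path T \<alpha> u) - F \<alpha>\<bar> < e / 2"
        using \<delta>(2)[OF shift_path_in_mspace[OF \<alpha>, of u]] True by simp
      moreover have "0 \<le> real n * \<bar>u\<bar>" by simp
      ultimately show ?thesis unfolding abs_less_iff by linarith
    next
      case False
      have "2 * B \<le> real N * \<delta>" using N \<delta>(1) by (simp add: divide_simps mult.commute)
      also have "\<dots> \<le> real n * \<bar>u\<bar>" using that False \<delta>(1) by (intro mult_mono) auto
      finally have "2 * B \<le> real n * \<bar>u\<bar>" .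
      then show ?thesis
        using bdd[OF \<alpha>] bdd[OF shift_path_in_mspace[OF \<alpha>, of u]] \<open>0 < e\<close> by (simp add: abs_le_iff)
    qed
    then have "F \<alpha> - e / 2 \<le> inf_conv T (real n) F \<alpha>"
      unfolding inf_conv_def by (intro cINF_greatest) auto
    moreover have "inf_conv T (real n) F \<alpha> \<le> F \<alpha>"
      by (rule inf_conv_le[OF T _ bdd mono \<alpha>]) simp
    ultimately show ?thesis using \<open>0 < e\<close> by (simp add: abs_less_iff)
  qed
  then show "\<exists>N. \<forall>n\<ge>N. norm (inf_conv T (real n) F \<alpha> - F \<alpha>) < e" by blast
qed

section \<open>The comonotony principle\<close>

text \<open>\<open>gaussian_process\<close> speaks of sums over sets of times, whereas \<tau> may
  repeat a time. The coefficients of equal times are therefore collected first.\<close>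

lemma gaussian_process_sequence:
  assumes "prob_space M" "gaussian_process M I X" "\<And>t. t \<in> I \<Longrightarrow> integral\<^sup>L M (X t) = 0"
    and \<tau>: "\<And>i. \<tau> i \<in> I"
  shows "centered_gaussian_sequence M (\<lambda>i. X (\<tau> i))"
proof -
  interpret prob_space M by fact
  show ?thesis
  proof
    fix n and a :: "nat \<Rightarrow> real"
    have "(\<Sum>i<n. a i * X (\<tau> i) \<omega>) = (\<Sum>t\<in>\<tau> ` {..<n}. (\<Sum>i\<in>{i \<in> {..<n}. \<tau> i = t}. a i) * X t \<omega>)" for \<omega>
    proof -
      have "(\<Sum>i<n. a i * X (\<tau> i) \<omega>) = (\<Sum>t\<in>\<tau> ` {..<n}. \<Sum>i\<in>{i \<in> {..<n}. \<tau> i = t}. a i * X (\<tau> i) \<omega>)"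
        by (rule sum.image_gen) simp
      also have "\<dots> = (\<Sum>t\<in>\<tau> ` {..<n}. (\<Sum>i\<in>{i \<in> {..<n}. \<tau> i = t}. a i) * X t \<omega>)"
        by (auto simp: sum_distrib_right intro!: sum.cong)
      finally show ?thesis .
    qed
    moreover have "finite (\<tau> ` {..<n})" "\<tau> ` {..<n} \<subseteq> I" using \<tau> by auto
    ultimately show "gaussian_rv M (\<lambda>\<omega>. \<Sum>i<n. a i * X (\<tau> i) \<omega>)"
      using assms(2) unfolding gaussian_process_def by simp
    show "integral\<^sup>L M (X (\<tau> i)) = 0" for i using assms(3) \<tau> by simp
  qed
qed

locale continuous_centered_gaussian = prob_space M for M :: "'a measure" +
  fixes X :: "real \<Rightarrow> 'a \<Rightarrow> real" and T :: real
  assumes T: "0 < T"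
    and gaussian: "gaussian_process M {0..T} X"
    and centered: "t \<in> {0..T} \<Longrightarrow> integral\<^sup>L M (X t) = 0"
    and continuous: "\<omega> \<in> space M \<Longrightarrow> continuous_on {0..T} (\<lambda>t. X t \<omega>)"
begin

lemma measurable_X: "t \<in> {0..T} \<Longrightarrow> X t \<in> borel_measurable M"
  using gaussian by (simp add: gaussian_process_def)

lemma sequence: "(\<And>i. \<tau> i \<in> {0..T}) \<Longrightarrow> centered_gaussian_sequence M (\<lambda>i. X (\<tau> i))"
  by (rule gaussian_process_sequence[OF prob_space_axioms gaussian centered])

lemma sample_in: "\<omega> \<in> space M \<Longrightarrow> sample_path T X \<omega> \<in> mspace (path_space T)"
  by (rule sample_path_in_mspace[where X = X], rule continuous)

lemma sample_measurable: "sample_path T X \<in> measurable M (path_borel T)"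
  by (rule sample_path_measurable[OF T measurable_X continuous])

lemma as_continuous_AE:
  assumes "as_continuous M T X F"
  shows "AE \<omega> in M. topcontinuous_at (mtopology_of (path_space T)) euclidean F (sample_path T X \<omega>)"
proof -
  obtain A where A: "A \<in> sets (path_borel T)" "measure (path_law M T X) A = 1"
    "\<And>\<alpha>. \<alpha> \<in> A \<Longrightarrow> topcontinuous_at (mtopology_of (path_space T)) euclidean F \<alpha>"
    using assms unfolding as_continuous_def by blast
  have "prob (sample_path T X -` A \<inter> space M) = 1"
    using A(1,2) sample_measurable by (simp add: path_law_def measure_distr)
  then have "AE \<omega> in M. \<omega> \<in> sample_path T X -` A \<inter> space M" by (rule AE_prob_1)
  then show ?thesis by (rule AE_mp) (use A(3) in auto)
qed

lemma as_continuousI: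
  assumes "\<And>\<alpha>. \<alpha> \<in> mspace (path_space T) \<Longrightarrow> topcontinuous_at (mtopology_of (path_space T)) euclidean F \<alpha>"
  shows "as_continuous M T X F"
proof -
  interpret L: prob_space "path_law M T X"
    unfolding path_law_def by (rule prob_space_distr[OF sample_measurable])
  have "measure (path_law M T X) (mspace (path_space T)) = 1"
    using L.prob_space by (simp add: path_law_def space_path_borel)
  then show ?thesis
    unfolding as_continuous_def using assms sets.top[of "path_borel T"]
    by (intro bexI[of _ "mspace (path_space T)"]) (auto simp: space_path_borel)
qed

text \<open>Association of the values at the nodes, applied to the functionals of the Bernstein
  path, followed by the limit in the degree.\<close>

lemma comonotony_lipschitz:
  assumes cov: "\<And>s t. s \<in> {0..T} \<Longrightarrow> t \<in> {0..T} \<Longrightarrow> 0 \<le> cov_fun M X s t"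
    and L: "0 \<le> L"
    and F: "path_lipschitz T L F" "\<And>\<alpha>. \<alpha> \<in> mspace (path_space T) \<Longrightarrow> \<bar>F \<alpha>\<bar> \<le> B"
      "monotone_on (mspace (path_space T)) (path_le T) (\<le>) F"
    and G: "path_lipschitz T L G" "\<And>\<alpha>. \<alpha> \<in> mspace (path_space T) \<Longrightarrow> \<bar>G \<alpha>\<bar> \<le> B"
      "monotone_on (mspace (path_space T)) (path_le T) (\<le>) G"
  shows "(\<integral>\<omega>. F (sample_path T X \<omega>) \<partial>M) * (\<integral>\<omega>. G (sample_path T X \<omega>) \<partial>M)
    \<le> (\<integral>\<omega>. F (sample_path T X \<omega>) * G (sample_path T X \<omega>) \<partial>M)"
proof -
  define Y where "Y n k = X (node T n k)" for n k
  have node: "node T n k \<in> {0..T}" for n k using node_in[of T] T by simp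
  have Ym: "Y n k \<in> borel_measurable M" for n k unfolding Y_def by (rule measurable_X[OF node])
  let ?b = "\<lambda>n \<omega>. bernstein_path T n (\<lambda>k. Y n k \<omega>)"
  have ineq: "(\<integral>\<omega>. F (?b n \<omega>) \<partial>M) * (\<integral>\<omega>. G (?b n \<omega>) \<partial>M) \<le> (\<integral>\<omega>. F (?b n \<omega>) * G (?b n \<omega>) \<partial>M)" for n
  proof -
    interpret centered_gaussian_sequence M "Y n"
      unfolding Y_def by (rule sequence[OF node])
    show ?thesis
    proof (rule association_lipschitz[where B = B, OF _ L l1_lipschitz_bernstein[OF T F(1) L] _ _ l1_lipschitz_bernstein[OF T G(1) L]])
      show "0 \<le> (\<integral>\<omega>. Y n i \<omega> * Y n j \<omega> \<partial>M)" for i j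
        using cov[OF node node] by (simp add: cov_fun_def Y_def)
      show "F (bernstein_path T n x) \<le> F (bernstein_path T n y)" "G (bernstein_path T n x) \<le> G (bernstein_path T n y)"
        if "\<And>i. x i \<le> y i" for x y
        using F(3) G(3) bernstein_path_mono[OF T that] bernstein_path_in_mspace
        by (simp_all add: monotone_on_def)
    qed (simp_all add: F(2) G(2) bernstein_path_in_mspace)
  qed
  have Fm: "(\<lambda>\<omega>. F (?b n \<omega>)) \<in> borel_measurable M" and Gm: "(\<lambda>\<omega>. G (?b n \<omega>)) \<in> borel_measurable M" for n
    using continuous_imp_borel_measurable_seq[OF l1_lipschitz_continuous[OF l1_lipschitz_bernstein[OF T F(1) L]] Ym]
      continuous_imp_borel_measurable_seq[OF l1_lipschitz_continuous[OF l1_lipschitz_bernstein[OF T G(1) L]] Ym]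
    by auto
  have Flim: "AE \<omega> in M. (\<lambda>n. F (?b n \<omega>)) \<longlonglongrightarrow> F (sample_path T X \<omega>)"
    unfolding Y_def by (intro AE_I2 sample_path_bernstein_tendsto[OF T F(1)] continuous)
  have Glim: "AE \<omega> in M. (\<lambda>n. G (?b n \<omega>)) \<longlonglongrightarrow> G (sample_path T X \<omega>)"
    unfolding Y_def by (intro AE_I2 sample_path_bernstein_tendsto[OF T G(1)] continuous)
  have Fs: "(\<lambda>\<omega>. F (sample_path T X \<omega>)) \<in> borel_measurable M" and Gs: "(\<lambda>\<omega>. G (sample_path T X \<omega>)) \<in> borel_measurable M"
    by (rule path_lipschitz_sample_measurable[OF T L F(1) measurable_X continuous]
        path_lipschitz_sample_measurable[OF T L G(1) measurable_X continuous]; assumption)+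
  show ?thesis
    by (rule covariance_nonneg_limit[OF Fm Gm Fs Gs Flim Glim _ _ ineq, where B = B])
       (simp_all add: F(2) G(2) bernstein_path_in_mspace)
qed

text \<open>The Lipschitz constant n of the inf-convolutions grows, but it does not occur in the
  inequality for Lipschitz functionals. Almost sure continuity gives convergence at almost every
  sample path.\<close>

lemma comonotony_increasing:
  assumes cov: "\<And>s t. s \<in> {0..T} \<Longrightarrow> t \<in> {0..T} \<Longrightarrow> 0 \<le> cov_fun M X s t"
    and F: "F \<in> borel_measurable (path_borel T)" "\<And>\<alpha>. \<alpha> \<in> mspace (path_space T) \<Longrightarrow> \<bar>F \<alpha>\<bar> \<le> B"
      "monotone_on (mspace (path_space T)) (path_le T) (\<le>) F" "as_continuous M T X F"
    and G: "G \<in> borel_measurable (path_borel T)" "\<And>\<alpha>. \<alpha> \<in> mspace (path_space T) \<Longrightarrow> \<bar>G \<alpha>\<bar> \<le> B"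
      "monotone_on (mspace (path_space T)) (path_le T) (\<le>) G" "as_continuous M T X G"
  shows "(\<integral>\<omega>. F (sample_path T X \<omega>) \<partial>M) * (\<integral>\<omega>. G (sample_path T X \<omega>) \<partial>M)
    \<le> (\<integral>\<omega>. F (sample_path T X \<omega>) * G (sample_path T X \<omega>) \<partial>M)"
proof -
  have lip: "path_lipschitz T (real n) (inf_conv T (real n) F)" "path_lipschitz T (real n) (inf_conv T (real n) G)" for n
    by (rule inf_conv_lipschitz[OF T _ F(2,3)] inf_conv_lipschitz[OF T _ G(2,3)]; simp)+
  have bdd: "\<bar>inf_conv T (real n) F \<alpha>\<bar> \<le> B" "\<bar>inf_conv T (real n) G \<alpha>\<bar> \<le> B"
    if "\<alpha> \<in> mspace (path_space T)" for n \<alpha>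
    by (rule inf_conv_bounded[OF T _ F(2,3) that] inf_conv_bounded[OF T _ G(2,3) that]; simp)+
  have mono: "monotone_on (mspace (path_space T)) (path_le T) (\<le>) (inf_conv T (real n) F)"
    "monotone_on (mspace (path_space T)) (path_le T) (\<le>) (inf_conv T (real n) G)" for n
    by (rule monotone_onI; rule inf_conv_mono[OF T _ F(2,3)] inf_conv_mono[OF T _ G(2,3)]; simp)+
  note meas = path_lipschitz_sample_measurable[OF T of_nat_0_le_iff _ measurable_X continuous]
  have Flim: "AE \<omega> in M. (\<lambda>n. inf_conv T (real n) F (sample_path T X \<omega>)) \<longlonglongrightarrow> F (sample_path T X \<omega>)"
    using as_continuous_AE[OF F(4)] by (rule AE_mp) (intro AE_I2 impI inf_conv_tendsto[OF T F(2,3)])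
  have Glim: "AE \<omega> in M. (\<lambda>n. inf_conv T (real n) G (sample_path T X \<omega>)) \<longlonglongrightarrow> G (sample_path T X \<omega>)"
    using as_continuous_AE[OF G(4)] by (rule AE_mp) (intro AE_I2 impI inf_conv_tendsto[OF T G(2,3)])
  show ?thesis
  proof (rule covariance_nonneg_limit[OF _ _ _ _ Flim Glim, where B = B])
    fix n
    show "(\<lambda>\<omega>. inf_conv T (real n) F (sample_path T X \<omega>)) \<in> borel_measurable M"
      "(\<lambda>\<omega>. inf_conv T (real n) G (sample_path T X \<omega>)) \<in> borel_measurable M"
      by (rule meas[OF lip(1)] meas[OF lip(2)]; assumption)+
    show "(\<integral>\<omega>. inf_conv T (real n) F (sample_path T X \<omega>) \<partial>M) * (\<integral>\<omega>. inf_conv T (real n) G (sample_path T X \<omega>) \<partial>M)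
      \<le> (\<integral>\<omega>. inf_conv T (real n) F (sample_path T X \<omega>) * inf_conv T (real n) G (sample_path T X \<omega>) \<partial>M)"
      by (rule comonotony_lipschitz[OF cov _ lip(1) bdd(1) mono(1) lip(2) bdd(2) mono(2)]) auto
  qed (use measurable_compose[OF sample_measurable F(1)] measurable_compose[OF sample_measurable G(1)] in
      \<open>simp_all add: bdd sample_in\<close>)
qed

lemma comonotony_if_cov_nonneg:
  assumes cov: "\<And>s t. s \<in> {0..T} \<Longrightarrow> t \<in> {0..T} \<Longrightarrow> 0 \<le> cov_fun M X s t"
  shows "functional_comonotony M T X"
  unfolding functional_comonotony_def
proof (intro allI impI)
  fix F G :: "(real \<Rightarrow> real) \<Rightarrow> real"
  assume m: "F \<in> borel_measurable (path_borel T)" "G \<in> borel_measurable (path_borel T)"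
    and b: "bounded (F ` mspace (path_space T))" "bounded (G ` mspace (path_space T))"
    and co: "comonotone T F G" and c: "as_continuous M T X F" "as_continuous M T X G"
  obtain B1 where B1: "\<And>\<alpha>. \<alpha> \<in> mspace (path_space T) \<Longrightarrow> \<bar>F \<alpha>\<bar> \<le> B1"
    using b(1) by (auto simp: bounded_iff)
  obtain B2 where B2: "\<And>\<alpha>. \<alpha> \<in> mspace (path_space T) \<Longrightarrow> \<bar>G \<alpha>\<bar> \<le> B2"
    using b(2) by (auto simp: bounded_iff)
  define B where "B = max B1 B2"
  have B: "\<bar>F \<alpha>\<bar> \<le> B" "\<bar>G \<alpha>\<bar> \<le> B" if "\<alpha> \<in> mspace (path_space T)" for \<alpha>
    using B1[OF that] B2[OF that] by (simp_all add: B_def)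
  from co consider "monotone_on (mspace (path_space T)) (path_le T) (\<le>) F" "monotone_on (mspace (path_space T)) (path_le T) (\<le>) G"
    | "monotone_on (mspace (path_space T)) (path_le T) (\<ge>) F" "monotone_on (mspace (path_space T)) (path_le T) (\<ge>) G"
    unfolding comonotone_def by blast
  then show "(\<integral>\<omega>. F (sample_path T X \<omega>) \<partial>M) * (\<integral>\<omega>. G (sample_path T X \<omega>) \<partial>M)
    \<le> (\<integral>\<omega>. F (sample_path T X \<omega>) * G (sample_path T X \<omega>) \<partial>M)"
  proof cases
    case 1
    show ?thesis by (rule comonotony_increasing[OF cov m(1) B(1) 1(1) c(1) m(2) B(2) 1(2) c(2)])
  next
    case 2
    \<comment> \<open>The regularization is set up for non-decreasing functionals. Negating both
      leaves the two sides of the inequality unchanged.\<close>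
    have neg: "as_continuous M T X (\<lambda>\<alpha>. - H \<alpha>)" if "as_continuous M T X H" for H
    proof -
      have "topcontinuous_at (mtopology_of (path_space T)) euclidean (\<lambda>\<alpha>. - H \<alpha>) \<alpha>"
        if "topcontinuous_at (mtopology_of (path_space T)) euclidean H \<alpha>" for \<alpha>
        using that unfolding topcontinuous_at_path_space by (simp add: abs_minus_commute)
      then show ?thesis using that unfolding as_continuous_def by blast
    qed
    have "(\<integral>\<omega>. - F (sample_path T X \<omega>) \<partial>M) * (\<integral>\<omega>. - G (sample_path T X \<omega>) \<partial>M)
      \<le> (\<integral>\<omega>. - F (sample_path T X \<omega>) * - G (sample_path T X \<omega>) \<partial>M)"
      by (rule comonotony_increasing[where F = "\<lambda>\<alpha>. - F \<alpha>" and G = "\<lambda>\<alpha>. - G \<alpha>" and B = B, OF cov])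
         (use 2 m B in \<open>auto simp: monotone_on_def intro!: neg c\<close>)
    then show ?thesis by simp
  qed
qed

text \<open>The evaluations at \<open>s\<close> and \<open>t\<close> are monotone and continuous but
  unbounded, so they are clipped at n. Letting n grow, the product of means tends to 0 because the
  process is centered, and the mixed moment tends to the covariance.\<close>

lemma cov_nonneg_if_comonotony:
  assumes fc: "functional_comonotony M T X" and s: "s \<in> {0..T}" and t: "t \<in> {0..T}"
  shows "0 \<le> cov_fun M X s t"
proof -
  \<comment> \<open>The sequence s, t, t, ... makes the moment bounds for Gaussian sequences
    available for \<open>X s\<close> and \<open>X t\<close>.\<close>
  define \<tau> where "\<tau> i = (if i = 0 then s else t)" for i :: nat
  interpret Y: centered_gaussian_sequence M "\<lambda>i. X (\<tau> i)"
    by (rule sequence) (use s t in \<open>simp add: \<tau>_def\<close>)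
  have int: "integrable M (X s)" "integrable M (X t)" "integrable M (\<lambda>\<omega>. X s \<omega> * X t \<omega>)"
    using Y.integrable_coord[of 0] Y.integrable_coord[of 1] Y.integrable_coord_mult[of 0 1] by (simp_all add: \<tau>_def)
  define clip where "clip n x = max (- real n) (min (real n) x)" for n and x :: real
  have clip_le: "\<bar>clip n x\<bar> \<le> \<bar>x\<bar>" "\<bar>clip n x\<bar> \<le> real n" "\<bar>clip n x - clip n y\<bar> \<le> \<bar>x - y\<bar>" for n x y
    by (auto simp: clip_def)
  have clip_mono: "x \<le> y \<Longrightarrow> clip n x \<le> clip n y" for n x y by (auto simp: clip_def)
  have clip_lim: "(\<lambda>n. clip n x) \<longlonglongrightarrow> x" for x
  proof (rule tendsto_eventually)
    obtain N where "\<bar>x\<bar> \<le> real N" using real_arch_simple by blast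
    then have "clip n x = x" if "N \<le> n" for n using that by (auto simp: clip_def)
    then show "\<forall>\<^sub>F n in sequentially. clip n x = x" by (auto simp: eventually_sequentially)
  qed
  have clip_meas [measurable]: "clip n \<in> borel_measurable borel" for n
    unfolding clip_def[abs_def] by measurable
  have lip: "path_lipschitz T 1 (\<lambda>\<alpha>. clip n (\<alpha> r))" if "r \<in> {0..T}" for n r
    unfolding path_lipschitz_def
    using order_trans[OF clip_le(3) abs_diff_le_mdist[OF _ _ _ that]] T by simp
  have ineq: "(\<integral>\<omega>. clip n (X s \<omega>) \<partial>M) * (\<integral>\<omega>. clip n (X t \<omega>) \<partial>M) \<le> (\<integral>\<omega>. clip n (X s \<omega>) * clip n (X t \<omega>) \<partial>M)" for n
  proof -
    have "bounded ((\<lambda>\<alpha>. clip n (\<alpha> r)) ` mspace (path_space T))" for r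
      using clip_le(2) by (auto simp: bounded_iff)
    moreover have "comonotone T (\<lambda>\<alpha>. clip n (\<alpha> s)) (\<lambda>\<alpha>. clip n (\<alpha> t))"
      using s t clip_mono by (auto simp: comonotone_def monotone_on_def path_le_def)
    moreover have "as_continuous M T X (\<lambda>\<alpha>. clip n (\<alpha> r))" if "r \<in> {0..T}" for r
      by (rule as_continuousI, rule path_lipschitz_topcontinuous_at[OF lip[OF that]])
    ultimately have "(\<integral>\<omega>. clip n (sample_path T X \<omega> s) \<partial>M) * (\<integral>\<omega>. clip n (sample_path T X \<omega> t) \<partial>M)
        \<le> (\<integral>\<omega>. clip n (sample_path T X \<omega> s) * clip n (sample_path T X \<omega> t) \<partial>M)"
      using fc[unfolded functional_comonotony_def, rule_format, of "\<lambda>\<alpha>. clip n (\<alpha> s)" "\<lambda>\<alpha>. clip n (\<alpha> t)"]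
        s t path_lipschitz_borel_measurable[OF lip] by simp
    then show ?thesis using s t by (simp add: sample_path_def)
  qed
  have [measurable]: "X s \<in> borel_measurable M" "X t \<in> borel_measurable M" using measurable_X s t by auto
  have "(\<lambda>n. \<integral>\<omega>. clip n (X s \<omega>) \<partial>M) \<longlonglongrightarrow> (\<integral>\<omega>. X s \<omega> \<partial>M)"
    by (rule integral_dominated_convergence[where w = "\<lambda>\<omega>. \<bar>X s \<omega>\<bar>"]) (use int clip_lim clip_le(1) in auto)
  moreover have "(\<lambda>n. \<integral>\<omega>. clip n (X t \<omega>) \<partial>M) \<longlonglongrightarrow> (\<integral>\<omega>. X t \<omega> \<partial>M)"
    by (rule integral_dominated_convergence[where w = "\<lambda>\<omega>. \<bar>X t \<omega>\<bar>"]) (use int clip_lim clip_le(1) in auto)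
  moreover have "(\<lambda>n. \<integral>\<omega>. clip n (X s \<omega>) * clip n (X t \<omega>) \<partial>M) \<longlonglongrightarrow> (\<integral>\<omega>. X s \<omega> * X t \<omega> \<partial>M)"
  proof (rule integral_dominated_convergence[where w = "\<lambda>\<omega>. \<bar>X s \<omega> * X t \<omega>\<bar>"])
    show "AE \<omega> in M. norm (clip n (X s \<omega>) * clip n (X t \<omega>)) \<le> \<bar>X s \<omega> * X t \<omega>\<bar>" for n
      by (intro AE_I2) (auto simp: abs_mult intro!: mult_mono clip_le(1))
    show "AE \<omega> in M. (\<lambda>n. clip n (X s \<omega>) * clip n (X t \<omega>)) \<longlonglongrightarrow> X s \<omega> * X t \<omega>"
      by (intro AE_I2 tendsto_mult clip_lim)
  qed (use int in auto)
  ultimately have "(\<integral>\<omega>. X s \<omega> \<partial>M) * (\<integral>\<omega>. X t \<omega> \<partial>M) \<le> (\<integral>\<omega>. X s \<omega> * X t \<omega> \<partial>M)"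
    using ineq by (intro LIMSEQ_le[OF tendsto_mult]) auto
  then show ?thesis using centered[OF s] by (simp add: cov_fun_def)
qed

end

theorem theorem4p1:
  fixes M :: "'a measure" and X :: "real \<Rightarrow> 'a \<Rightarrow> real" and T :: real
  assumes "0 < T"
    and "prob_space M"
    and "gaussian_process M {0..T} X"
    and "\<forall>t\<in>{0..T}. integral\<^sup>L M (X t) = 0"
    and "\<forall>\<omega>\<in>space M. continuous_on {0..T} (\<lambda>t. X t \<omega>)"
  shows "functional_comonotony M T X \<longleftrightarrow> (\<forall>s\<in>{0..T}. \<forall>t\<in>{0..T}. 0 \<le> cov_fun M X s t)"
proof -
  interpret prob_space M by fact
  interpret continuous_centered_gaussian M X T
    by standard (use assms in auto)
  show ?thesis using comonotony_if_cov_nonneg cov_nonneg_if_comonotony by blast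
qed

end
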